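(* Let $r\ge3$ and let $n_1,\ldots,n_r$ be positive integers. The parameter group of the quandle $U_{n_1,\ldots,n_r}$ is $$G'(U_{n_1,\ldots,n_r})\cong\mathbb{Z}_{\gcd(n_1,\ldots,n_r,2)}.$$ For $r=3$, its second homology group is $$H_2(U_{n_1,n_2,n_3})\cong\mathbb{Z}^9\oplus\mathbb{Z}_{\gcd(n_1,n_2,n_3,2)}^3;$$ in particular, all torsion groups coincide with the whole parameter group: $T_1\cong T_2\cong T_3\cong G'(U_{n_1,n_2,n_3})$. For $r\ge4$, there is no torsion: $$H_2(U_{n_1,\ldots,n_r})\cong\mathbb{Z}^{r^2}.$$
   Context: $\mathbb{Z}_k$ is the cyclic group of order $k$. A quandle is a set $X$ with a binary operation $\triangleleft$ such that for all $a,b,c$: $(a\triangleleft b)\triangleleft c=(a\triangleleft c)\triangleleft(b\triangleleft c)$; the right translation $-\triangleleft b$ is a bijection of $X$ (with inverse $-\mathbin{\widetilde{\triangleleft}}b$); $a\triangleleft a=a$. Its orbits are the orbits under the group generated by all right translations. It is abelian if $(a\triangleleft b)\triangleleft c=(a\triangleleft c)\triangleleft b$ for all $a,b,c$. Its structure group is $G=G(X,\triangleleft)=\langle g_a,\ a\in X\mid g_ag_b=g_bg_{a\triangleleft b}\rangle$, acting on $X$ on the right by $a\cdot g_b=a\triangleleft b$. The quandle $U_{n_1,\ldots,n_r}$: put $O_i=\mathbb{Z}_{n_i}$ and $U_{n_1,\ldots,n_r}=\bigsqcup_{i=1}^rO_i$, with $a\triangleleft b=a$ if $a,b$ are from the same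 $O_i$, and $a\triangleleft b=a+1$ (in the component of $a$) if $a,b$ are from different components. This is a finite abelian quandle with orbits $O_1,\ldots,O_r$. Parameters. A parameter collection is a family of integers $M=(m_{i,j})_{1\le j\le i<r}$ with $m_{i,i}\ge 1$ and $0\le m_{j,i}<m_{i,i}$ for $i<j$. It defines the finite abelian group $G(M)$ generated by pairwise commuting $x_1,\ldots,x_{r-1}$ subject to $x_1^{m_{i,1}}\cdots x_i^{m_{i,i}}=1$ for $1\le i\le r-1$. Put $x_0:=1$. Given $r$ parameter collections, let $Q(M^{(1)},\ldots,M^{(r)})=G(M^{(1)})\sqcup\cdots\sqcup G(M^{(r)})$, with $x_k^{(i)}$ denoting $x_k\in G(M^{(i)})$, and $a\triangleleft b=a\,x_k^{(i)}$ for $a\in G(M^{(i)})$, $b\in G(M^{(i+k)})$, $0\le k<r$ ($i+k$ modulo $r$). Every finite abelian quandle with ordered orbits $O_1,\ldots,O_r$ is isomorphic, by an isomorphism matching $O_i$ with $G(M^{(i)})$, to $Q(M^{(1)},\ldots,M^{(r)})$ for unique $M^{(i)}$, called its parameters. The parameter group is $G'(X,\triangleleft)=\prod_{i=1}^rG(M^{(i)})\big/\langle x^{(i)}_{j-i}x^{(j)}_{i-j},\ 1\le i<j\le r\rangle$ (lower indices modulo $r$). Rack homology: $C_k=\mathbb{Z}X^k$, $d_k(a_1,\ldots,a_k)=\sum_{i=2}^k(-1)^{i-1}[(a_1,\ldots,\widehat{a_i},\ldots,a_k)-(a_1\triangleleft a_i,\ldots,a_{i-1}\triangleleft a_i,a_{i+1},\ldots,a_k)]$;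 so $d_2(a,b)=a\triangleleft b-a$, $d_3(a,b,c)=(a\triangleleft b,c)-(a,c)-(a\triangleleft c,b\triangleleft c)+(a,b)$, $H_2=\ker d_2/\operatorname{im}d_3$. The complex splits over orbits into subcomplexes $C_{k;i}=\mathbb{Z}(O_i\times X^{k-1})$; let $Q_{2;i}=C_{2;i}/d_3(C_{3;i})$ and let $H_{2;i}\subseteq Q_{2;i}$ be the corresponding summand of $H_2$. Torsion groups: the path maps $p_a\colon G\to Q_{2;i}$ ($a\in O_i$) are the maps determined by $p_a(g_b)=(a,b)$, $p_a(g_b^{-1})=-(a\mathbin{\widetilde{\triangleleft}}b,b)$ and $p_a(gg')=p_a(g)+p_{a\cdot g}(g')$; they restrict to group morphisms from the stabiliser $G_a$ to $H_{2;i}$. For a finite abelian quandle, $[G,G]\subseteq G_a$, and the $i$-th torsion group is $T_i=p_a([G,G])\subseteq H_{2;i}$ for any $a\in O_i$ (independent of the choice of $a$). *)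

theory Defs
  imports "HOL-Algebra.Group_Action" "HOL-Algebra.Free_Abelian_Groups"
begin

section \<open>Quandles\<close>

locale quandle =
  fixes X :: "'a set" and tri :: "'a \<Rightarrow> 'a \<Rightarrow> 'a" (infixl \<open>\<triangleleft>\<close> 70)
  assumes closed: "\<lbrakk>a \<in> X; b \<in> X\<rbrakk> \<Longrightarrow> a \<triangleleft> b \<in> X"
    and self_distrib:
      "\<lbrakk>a \<in> X; b \<in> X; c \<in> X\<rbrakk> \<Longrightarrow> (a \<triangleleft> b) \<triangleleft> c = (a \<triangleleft> c) \<triangleleft> (b \<triangleleft> c)"
    and bij_translation: "b \<in> X \<Longrightarrow> bij_betw (\<lambda>a. a \<triangleleft> b) X X"
    and idem: "a \<in> X \<Longrightarrow> a \<triangleleft> a = a"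

locale finite_abelian_quandle = quandle +
  assumes finite: "finite X"
    and abelian: "\<lbrakk>a \<in> X; b \<in> X; c \<in> X\<rbrakk> \<Longrightarrow> (a \<triangleleft> b) \<triangleleft> c = (a \<triangleleft> c) \<triangleleft> b"

definition inverse_tri :: "'a set \<Rightarrow> ('a \<Rightarrow> 'a \<Rightarrow> 'a) \<Rightarrow> 'a \<Rightarrow> 'a \<Rightarrow> 'a"
  where "inverse_tri X t a b = inv_into X (\<lambda>x. t x b) a"

definition translation_group :: "'a set \<Rightarrow> ('a \<Rightarrow> 'a \<Rightarrow> 'a) \<Rightarrow> ('a \<Rightarrow> 'a) monoid"
  where "translation_group X t =
    subgroup_generated (BijGroup X) {\<lambda>a\<in>X. t a b | b. b \<in> X}"

definition quandle_orbits :: "'a set \<Rightarrow> ('a \<Rightarrow> 'a \<Rightarrow> 'a) \<Rightarrow> 'a set set"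
  where "quandle_orbits X t = orbits (translation_group X t) X (\<lambda>g. g)"

definition quandle_iso ::
    "('a \<Rightarrow> 'b) \<Rightarrow> 'a set \<Rightarrow> ('a \<Rightarrow> 'a \<Rightarrow> 'a) \<Rightarrow> 'b set \<Rightarrow> ('b \<Rightarrow> 'b \<Rightarrow> 'b) \<Rightarrow> bool"
  where "quandle_iso f X t Y s \<longleftrightarrow>
    bij_betw f X Y \<and> (\<forall>a\<in>X. \<forall>b\<in>X. f (t a b) = s (f a) (f b))"


section \<open>Groups presented by generators and relations\<close>

text \<open>In a word, the letters \<open>(x, True)\<close> and \<open>(x, False)\<close> stand for the generator
  of \<open>x\<close> and for its inverse.\<close>

type_synonym 'a word = "('a \<times> bool) list"

inductive pres_eq :: "'a set \<Rightarrow> ('a word \<times> 'a word) set \<Rightarrow> 'a word \<Rightarrow> 'a word \<Rightarrow> bool"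
  for S R where
  refl: "set u \<subseteq> S \<times> UNIV \<Longrightarrow> pres_eq S R u u"
| sym: "pres_eq S R u v \<Longrightarrow> pres_eq S R v u"
| trans: "pres_eq S R u v \<Longrightarrow> pres_eq S R v w \<Longrightarrow> pres_eq S R u w"
| append: "pres_eq S R u u' \<Longrightarrow> pres_eq S R v v' \<Longrightarrow> pres_eq S R (u @ v) (u' @ v')"
| cancel: "x \<in> S \<Longrightarrow> pres_eq S R [(x, e), (x, \<not> e)] []"
| relation: "(u, v) \<in> R \<Longrightarrow> pres_eq S R u v"

definition pres_class :: "'a set \<Rightarrow> ('a word \<times> 'a word) set \<Rightarrow> 'a word \<Rightarrow> 'a word set"
  where "pres_class S R u = {v. pres_eq S R u v}"

text \<open>The relations in \<open>R\<close> are meant to be pairs of words in the generators \<open>S\<close>.\<close>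

definition presented_group :: "'a set \<Rightarrow> ('a word \<times> 'a word) set \<Rightarrow> 'a word set monoid"
  where "presented_group S R =
    \<lparr>carrier = pres_class S R ` {u. set u \<subseteq> S \<times> UNIV},
     mult = (\<lambda>A B. \<Union>u\<in>A. \<Union>v\<in>B. pres_class S R (u @ v)),
     one = pres_class S R []\<rparr>"

definition structure_group :: "'a set \<Rightarrow> ('a \<Rightarrow> 'a \<Rightarrow> 'a) \<Rightarrow> 'a word set monoid"
  where "structure_group X t =
    presented_group X {([(a, True), (b, True)], [(b, True), (t a b, True)]) | a b. a \<in> X \<and> b \<in> X}"


section \<open>Parameters of finite abelian quandles\<close>

definition parameter_collection :: "nat \<Rightarrow> (nat \<Rightarrow> nat \<Rightarrow> int) \<Rightarrow> bool"
  where "parameter_collection r m \<longleftrightarrow>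
    (\<forall>i\<in>{1..<r}. m i i \<ge> 1) \<and> (\<forall>j\<in>{1..<r}. \<forall>i\<in>{1..<j}. 0 \<le> m j i \<and> m j i < m i i)"

definition collection_relations :: "nat \<Rightarrow> (nat \<Rightarrow> nat \<Rightarrow> int) \<Rightarrow> (nat \<Rightarrow>\<^sub>0 int) set"
  where "collection_relations r m =
    generate (free_Abelian_group {1..<r})
      {\<Sum>j=1..i. frag_cmul (m i j) (frag_of j) | i. i \<in> {1..<r}}"

definition collection_group :: "nat \<Rightarrow> (nat \<Rightarrow> nat \<Rightarrow> int) \<Rightarrow> (nat \<Rightarrow>\<^sub>0 int) set monoid"
  where "collection_group r m = free_Abelian_group {1..<r} Mod collection_relations r m"

definition collection_gen :: "nat \<Rightarrow> (nat \<Rightarrow> nat \<Rightarrow> int) \<Rightarrow> nat \<Rightarrow> (nat \<Rightarrow>\<^sub>0 int) set"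
  where "collection_gen r m k =
    (if k = 0 then \<one>\<^bsub>collection_group r m\<^esub>
     else collection_relations r m #>\<^bsub>free_Abelian_group {1..<r}\<^esub> frag_of k)"

text \<open>Indices run through \<open>{1..r}\<close>. For \<open>i, j\<close> in this range, the unique \<open>k\<close> with
  \<open>0 \<le> k < r\<close> and \<open>j = i + k\<close> modulo \<open>r\<close> is \<open>(j + r - i) mod r\<close>.\<close>

definition param_quandle :: "nat \<Rightarrow> (nat \<Rightarrow> nat \<Rightarrow> nat \<Rightarrow> int) \<Rightarrow> (nat \<times> (nat \<Rightarrow>\<^sub>0 int) set) set"
  where "param_quandle r M = (SIGMA i:{1..r}. carrier (collection_group r (M i)))"

fun param_tri ::
    "nat \<Rightarrow> (nat \<Rightarrow> nat \<Rightarrow> nat \<Rightarrow> int) \<Rightarrow> nat \<times> (nat \<Rightarrow>\<^sub>0 int) set \<Rightarrow>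
     nat \<times> (nat \<Rightarrow>\<^sub>0 int) set \<Rightarrow> nat \<times> (nat \<Rightarrow>\<^sub>0 int) set"
  where "param_tri r M (i, a) (j, b) =
    (i, a \<otimes>\<^bsub>collection_group r (M i)\<^esub> collection_gen r (M i) ((j + r - i) mod r))"

definition quandle_parameters ::
    "nat \<Rightarrow> 'a set \<Rightarrow> ('a \<Rightarrow> 'a \<Rightarrow> 'a) \<Rightarrow> (nat \<Rightarrow> 'a set) \<Rightarrow> (nat \<Rightarrow> nat \<Rightarrow> nat \<Rightarrow> int) \<Rightarrow> bool"
  where "quandle_parameters r X t Orb M \<longleftrightarrow>
    finite_abelian_quandle X t \<and>
    bij_betw Orb {1..r} (quandle_orbits X t) \<and>
    (\<forall>i\<in>{1..r}. parameter_collection r (M i)) \<and>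
    (\<exists>f. quandle_iso f X t (param_quandle r M) (param_tri r M) \<and>
         (\<forall>i\<in>{1..r}. f ` Orb i = {i} \<times> carrier (collection_group r (M i))))"

definition collections_product ::
    "nat \<Rightarrow> (nat \<Rightarrow> nat \<Rightarrow> nat \<Rightarrow> int) \<Rightarrow> (nat \<Rightarrow> (nat \<Rightarrow>\<^sub>0 int) set) monoid"
  where "collections_product r M = product_group {1..r} (\<lambda>i. collection_group r (M i))"

definition factor_elem ::
    "nat \<Rightarrow> (nat \<Rightarrow> nat \<Rightarrow> nat \<Rightarrow> int) \<Rightarrow> nat \<Rightarrow> (nat \<Rightarrow>\<^sub>0 int) set \<Rightarrow> nat \<Rightarrow> (nat \<Rightarrow>\<^sub>0 int) set"
  where "factor_elem r M i g =
    (\<lambda>l\<in>{1..r}. if l = i then g else \<one>\<^bsub>collection_group r (M l)\<^esub>)"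

definition parameter_group ::
    "nat \<Rightarrow> (nat \<Rightarrow> nat \<Rightarrow> nat \<Rightarrow> int) \<Rightarrow> (nat \<Rightarrow> (nat \<Rightarrow>\<^sub>0 int) set) set monoid"
  where "parameter_group r M =
    collections_product r M Mod
      generate (collections_product r M)
        {factor_elem r M i (collection_gen r (M i) (j - i)) \<otimes>\<^bsub>collections_product r M\<^esub>
         factor_elem r M j (collection_gen r (M j) (r + i - j)) | i j. 1 \<le> i \<and> i < j \<and> j \<le> r}"


section \<open>Rack homology\<close>

definition tuples :: "'a set \<Rightarrow> nat \<Rightarrow> 'a list set"
  where "tuples X k = {xs. set xs \<subseteq> X \<and> length xs = k}"

definition rack_chains :: "'a set \<Rightarrow> nat \<Rightarrow> ('a list \<Rightarrow>\<^sub>0 int) monoid"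
  where "rack_chains X k = free_Abelian_group (tuples X k)"

text \<open>The differential in all degrees at once. List positions are counted from 0, so position
  \<open>i\<close> is the entry \<open>a\<^bsub>i+1\<^esub>\<close> of the tuple, and the sign \<open>(-1)\<^bsup>i-1\<^esup>\<close> of the
  usual formula becomes \<open>(-1)\<^bsup>i\<^esup>\<close>.\<close>

definition rack_boundary :: "('a \<Rightarrow> 'a \<Rightarrow> 'a) \<Rightarrow> ('a list \<Rightarrow>\<^sub>0 int) \<Rightarrow> ('a list \<Rightarrow>\<^sub>0 int)"
  where "rack_boundary t = frag_extend (\<lambda>xs.
    \<Sum>i\<in>{1..<length xs}. frag_cmul ((-1) ^ i)
      (frag_of (take i xs @ drop (Suc i) xs) -
       frag_of (map (\<lambda>a. t a (xs ! i)) (take i xs) @ drop (Suc i) xs)))"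

lemma rack_boundary_2: "rack_boundary t (frag_of [a, b]) = frag_of [t a b] - frag_of [a]"
  by (simp add: rack_boundary_def)

lemma rack_boundary_3:
  "rack_boundary t (frag_of [a, b, c]) =
     frag_of [t a b, c] - frag_of [a, c] - frag_of [t a c, t b c] + frag_of [a, b]"
  by (simp add: rack_boundary_def numeral_3_eq_3 atLeastLessThanSuc)

definition rack_homology :: "nat \<Rightarrow> 'a set \<Rightarrow> ('a \<Rightarrow> 'a \<Rightarrow> 'a) \<Rightarrow> ('a list \<Rightarrow>\<^sub>0 int) set monoid"
  where "rack_homology k X t =
    subgroup_generated (rack_chains X k)
      (kernel (rack_chains X k) (rack_chains X (k - 1)) (rack_boundary t)) Mod
    (rack_boundary t ` carrier (rack_chains X (Suc k)))"

text \<open>For a union \<open>Y\<close> of orbits, the subcomplex spanned by the tuples with first entry in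
  \<open>Y\<close> (in degrees \<open>k \<ge> 1\<close>).\<close>

definition orbit_chains :: "'a set \<Rightarrow> 'a set \<Rightarrow> nat \<Rightarrow> ('a list \<Rightarrow>\<^sub>0 int) monoid"
  where "orbit_chains X Y k = free_Abelian_group {xs \<in> tuples X k. hd xs \<in> Y}"

definition orbit_boundaries_2 :: "'a set \<Rightarrow> ('a \<Rightarrow> 'a \<Rightarrow> 'a) \<Rightarrow> 'a set \<Rightarrow> ('a list \<Rightarrow>\<^sub>0 int) set"
  where "orbit_boundaries_2 X t Y = rack_boundary t ` carrier (orbit_chains X Y 3)"

definition orbit_quotient_2 ::
    "'a set \<Rightarrow> ('a \<Rightarrow> 'a \<Rightarrow> 'a) \<Rightarrow> 'a set \<Rightarrow> ('a list \<Rightarrow>\<^sub>0 int) set monoid"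
  where "orbit_quotient_2 X t Y = orbit_chains X Y 2 Mod orbit_boundaries_2 X t Y"


section \<open>Path maps and torsion groups\<close>

fun path_chain :: "'a set \<Rightarrow> ('a \<Rightarrow> 'a \<Rightarrow> 'a) \<Rightarrow> 'a \<Rightarrow> 'a word \<Rightarrow> ('a list \<Rightarrow>\<^sub>0 int)" where
  "path_chain X t a [] = 0"
| "path_chain X t a ((b, True) # w) = frag_of [a, b] + path_chain X t (t a b) w"
| "path_chain X t a ((b, False) # w) =
     - frag_of [inverse_tri X t a b, b] + path_chain X t (inverse_tri X t a b) w"

text \<open>The classes of the chains along all words representing \<open>g\<close> coincide, so the union below
  is a single coset.\<close>

definition path_map ::
    "'a set \<Rightarrow> ('a \<Rightarrow> 'a \<Rightarrow> 'a) \<Rightarrow> 'a set \<Rightarrow> 'a \<Rightarrow> 'a word set \<Rightarrow> ('a list \<Rightarrow>\<^sub>0 int) set"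
  where "path_map X t Y a g =
    (\<Union>w\<in>g. orbit_boundaries_2 X t Y #>\<^bsub>orbit_chains X Y 2\<^esub> path_chain X t a w)"

definition torsion_group ::
    "'a set \<Rightarrow> ('a \<Rightarrow> 'a \<Rightarrow> 'a) \<Rightarrow> 'a set \<Rightarrow> 'a \<Rightarrow> ('a list \<Rightarrow>\<^sub>0 int) set monoid"
  where "torsion_group X t Y a =
    (orbit_quotient_2 X t Y)
      \<lparr>carrier := path_map X t Y a ` derived (structure_group X t) (carrier (structure_group X t))\<rparr>"


section \<open>The quandles \<open>U\<close>\<close>

definition U_orbit :: "(nat \<Rightarrow> nat) \<Rightarrow> nat \<Rightarrow> (nat \<times> int) set"
  where "U_orbit n i = {i} \<times> carrier (integer_mod_group (n i))"

definition U_quandle :: "nat \<Rightarrow> (nat \<Rightarrow> nat) \<Rightarrow> (nat \<times> int) set"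
  where "U_quandle r n = (\<Union>i\<in>{1..r}. U_orbit n i)"

fun U_tri :: "(nat \<Rightarrow> nat) \<Rightarrow> nat \<times> int \<Rightarrow> nat \<times> int \<Rightarrow> nat \<times> int"
  where "U_tri n (i, x) (j, y) =
    (if i = j then (i, x) else (i, x \<otimes>\<^bsub>integer_mod_group (n i)\<^esub> 1))"

end

theory Submission
  imports Defs
begin

text \<open>
  Fix an orbit \<open>O\<^sub>i\<close> and consider the chains \<open>(a, b)\<close> with \<open>a \<in> O\<^sub>i\<close> modulo boundaries. The boundary
  relations say that moving \<open>b \<notin> O\<^sub>i\<close> one step, or moving \<open>a\<close> one step when \<open>b \<in> O\<^sub>i\<close>, adds
  one and the same element \<open>e\<^sub>i\<close>, and that moving \<open>a\<close> one step has effects on the columns of two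
  other orbits \<open>O\<^sub>j\<close>, \<open>O\<^sub>k\<close> which differ by \<open>e\<^sub>i\<close>. Exchanging \<open>j\<close> and \<open>k\<close> gives \<open>2 e\<^sub>i = 0\<close>, going
  around an orbit gives \<open>n\<^sub>j e\<^sub>i = 0\<close> for all \<open>j\<close>, and a fourth orbit forces \<open>e\<^sub>i = 0\<close>. This yields a
  normal form for chains; counting functionals and, for \<open>r = 3\<close>, a parity functional detecting \<open>e\<^sub>i\<close>
  show that there are no further relations. Paths along commutators are cycles on which all counting
  functionals vanish, so the torsion groups are generated by the \<open>e\<^sub>i\<close>.
  The parameter group is presented by generators \<open>x\<^sub>1, \<dots>, x\<^sub>r\<close> of order \<open>n\<^sub>i\<close> with \<open>x\<^sub>i x\<^sub>j = 1\<close> for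
  \<open>i \<noteq> j\<close>; as \<open>r \<ge> 3\<close>, all \<open>x\<^sub>i\<close> coincide and have order dividing 2.
\<close>

section \<open>Subgroups of free abelian groups\<close>

text \<open>Quotients are not formed during the computation: congruences are stated as membership of
  differences of chains in a set of boundaries, and \<open>frag_subgroup\<close> collects the
  closure properties that this requires. The rank is found column by column. For each orbit
  \<open>i\<close> there are a cycle in its own column, a full turn of the orbit through one
  distinguished column (the pivot), and \<open>r - 2\<close> differences between the remaining
  columns and the pivot: \<open>r\<close> cycles for each of \<open>r\<close> orbits. Singling out a
  pivot breaks the symmetry of the other columns, and the parity functional demands this. When the
  first entry moves one step, the parity must change in exactly one of any two other columns. With
  two such columns this calls for a choice; with three it is impossible. The claim about the
  parameter group concerns every admissible family \<open>M\<close>. The relations between its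
  generators are therefore extracted from an arbitrary isomorphism, while the explicit family
  \<open>U_parameters\<close> settles existence.\<close>

locale frag_subgroup =
  fixes B :: "('a \<Rightarrow>\<^sub>0 int) set"
  assumes zero_mem: "0 \<in> B"
    and diff_mem: "\<lbrakk>u \<in> B; v \<in> B\<rbrakk> \<Longrightarrow> u - v \<in> B"
begin

lemma uminus_mem: "u \<in> B \<Longrightarrow> - u \<in> B"
  using diff_mem[OF zero_mem] by simp

lemma add_mem: "\<lbrakk>u \<in> B; v \<in> B\<rbrakk> \<Longrightarrow> u + v \<in> B"
  using diff_mem[of u "- v"] uminus_mem by simp

lemma cmul_mem: "u \<in> B \<Longrightarrow> frag_cmul k u \<in> B"
  by (rule frag_closure_minus_cmul) (auto intro: zero_mem diff_mem)

lemma sum_mem: "(\<And>i. i \<in> I \<Longrightarrow> f i \<in> B) \<Longrightarrow> sum f I \<in> B"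
  by (induction I rule: infinite_finite_induct) (auto intro: zero_mem add_mem)

text \<open>Equal increments modulo \<open>B\<close> add up, in both directions along the integers.
  Evaluated at a period of \<open>h\<close>, this puts a multiple of \<open>e\<close> into
  \<open>B\<close>, which is how the orders \<open>n j\<close> enter.\<close>

lemma progression:
  assumes "\<And>x::int. h (x + 1) - h x - e \<in> B"
  shows "h x - h 0 - frag_cmul x e \<in> B"
proof (induction x rule: int_induct[where k = 0])
  case base
  show ?case by (simp add: zero_mem)
next
  case (step1 i)
  from add_mem[OF step1(2) assms[of i]] show ?case
    by (simp add: frag_cmul_distrib algebra_simps)
next
  case (step2 i)
  from diff_mem[OF step2(2) assms[of "i - 1"]] show ?case
    by (simp add: frag_cmul_diff_distrib algebra_simps)
qed

lemma gcd_cmul_mem: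
  assumes "frag_cmul a u \<in> B" "frag_cmul b u \<in> B"
  shows "frag_cmul (gcd a b) u \<in> B"
proof -
  obtain p q where "p * a + q * b = gcd a b"
    using bezout_int by blast
  then show ?thesis
    using add_mem[OF cmul_mem[OF assms(1), of p] cmul_mem[OF assms(2), of q]]
    by (simp flip: frag_cmul_distrib)
qed

lemma Gcd_cmul_mem:
  assumes "finite I" "\<And>i. i \<in> I \<Longrightarrow> frag_cmul (int (n i)) u \<in> B"
  shows "frag_cmul (int (Gcd (n ` I))) u \<in> B"
  using assms
proof (induction I rule: finite_induct)
  case empty
  then show ?case by (simp add: zero_mem)
next
  case (insert i I)
  then have "frag_cmul (gcd (int (n i)) (int (Gcd (n ` I)))) u \<in> B"
    by (intro gcd_cmul_mem) auto
  then show ?case by simp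
qed

lemma subgroup_free_Abelian_group:
  assumes "\<And>u. u \<in> B \<Longrightarrow> Poly_Mapping.keys u \<subseteq> S"
  shows "subgroup B (free_Abelian_group S)"
  using assms by unfold_locales (auto simp: zero_mem add_mem uminus_mem dest: assms)

lemma r_coset_eq_iff:
  "B #>\<^bsub>free_Abelian_group S\<^esub> u = B #>\<^bsub>free_Abelian_group S\<^esub> v \<longleftrightarrow> u - v \<in> B"
proof
  assume "B #>\<^bsub>free_Abelian_group S\<^esub> u = B #>\<^bsub>free_Abelian_group S\<^esub> v"
  moreover have "u \<in> B #>\<^bsub>free_Abelian_group S\<^esub> u"
    using zero_mem by (force simp: r_coset_def)
  ultimately obtain b where "b \<in> B" "u = b + v"
    by (auto simp: r_coset_def)
  then show "u - v \<in> B" by simp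
next
  assume uv: "u - v \<in> B"
  have "\<exists>c\<in>B. b + u = c + v" "\<exists>c\<in>B. b + v = c + u" if "b \<in> B" for b
    using that add_mem[OF that uv] diff_mem[OF that uv]
    by (force simp: algebra_simps intro: bexI[of _ "b + (u - v)"] bexI[of _ "b - (u - v)"])+
  then show "B #>\<^bsub>free_Abelian_group S\<^esub> u = B #>\<^bsub>free_Abelian_group S\<^esub> v"
    unfolding r_coset_def by auto
qed

end

lemma frag_subgroup_image:
  "frag_subgroup (frag_extend f ` carrier (free_Abelian_group S))"
proof
  show "0 \<in> frag_extend f ` carrier (free_Abelian_group S)"
    by (intro image_eqI[of _ _ 0]) auto
next
  fix u v
  assume "u \<in> frag_extend f ` carrier (free_Abelian_group S)"
    "v \<in> frag_extend f ` carrier (free_Abelian_group S)"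
  then obtain u' v' where "u = frag_extend f u'" "v = frag_extend f v'"
    "Poly_Mapping.keys u' \<subseteq> S" "Poly_Mapping.keys v' \<subseteq> S"
    by auto
  then show "u - v \<in> frag_extend f ` carrier (free_Abelian_group S)"
    using keys_diff[of u' v']
    by (intro image_eqI[of _ _ "u' - v'"]) (auto simp: frag_extend_diff)
qed

lemma frag_extend_image_induct [consumes 1, case_names zero diff gen]:
  assumes "z \<in> frag_extend f ` carrier (free_Abelian_group S)"
    and "P 0" "\<And>u v. P u \<Longrightarrow> P v \<Longrightarrow> P (u - v)" "\<And>s. s \<in> S \<Longrightarrow> P (f s)"
  shows "P z"
proof -
  obtain c where c: "z = frag_extend f c" "Poly_Mapping.keys c \<subseteq> S"
    using assms(1) by auto
  have "P (frag_extend f c)"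
    using c(2)
    by (rule free_Abelian_group_induct[where P = "\<lambda>c. P (frag_extend f c)"])
      (auto simp: frag_extend_diff assms)
  with c show ?thesis by simp
qed

text \<open>The linear extension of \<open>f\<close> to an integer-valued functional. As
  \<open>frag_extend\<close> takes values in free abelian groups, the integers are represented by
  the free abelian group on one point.\<close>

definition frag_eval :: "('a \<Rightarrow> int) \<Rightarrow> ('a \<Rightarrow>\<^sub>0 int) \<Rightarrow> int"
  where "frag_eval f z =
    Poly_Mapping.lookup (frag_extend (\<lambda>s. frag_cmul (f s) (frag_of ())) z) ()"

lemma frag_eval_simps [simp]:
  "frag_eval f 0 = 0"
  "frag_eval f (frag_of s) = f s"
  "frag_eval f (u + v) = frag_eval f u + frag_eval f v"
  "frag_eval f (u - v) = frag_eval f u - frag_eval f v"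
  "frag_eval f (- u) = - frag_eval f u"
  "frag_eval f (frag_cmul k u) = k * frag_eval f u"
  by (simp_all add: frag_eval_def frag_extend_add frag_extend_diff frag_extend_minus
      frag_extend_cmul lookup_add lookup_minus)

lemma frag_eval_sum [simp]: "frag_eval f (sum u I) = (\<Sum>i\<in>I. frag_eval f (u i))"
  by (induction I rule: infinite_finite_induct) auto

section \<open>Presented groups\<close>

definition word_inv :: "'a word \<Rightarrow> 'a word"
  where "word_inv u = rev (map (\<lambda>(x, e). (x, \<not> e)) u)"

lemma word_inv_simps [simp]:
  "word_inv [] = []" "word_inv ((x, e) # u) = word_inv u @ [(x, \<not> e)]"
  by (auto simp: word_inv_def)

locale presentation =
  fixes S :: "'a set" and R :: "('a word \<times> 'a word) set"
  assumes relators: "(u, v) \<in> R \<Longrightarrow> set u \<subseteq> S \<times> UNIV \<and> set v \<subseteq> S \<times> UNIV"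
begin

lemma pres_eq_in_S: "pres_eq S R u v \<Longrightarrow> set u \<subseteq> S \<times> UNIV \<and> set v \<subseteq> S \<times> UNIV"
  by (induction rule: pres_eq.induct) (auto dest: relators)

lemma pres_class_eq_iff:
  assumes "set u \<subseteq> S \<times> UNIV"
  shows "pres_class S R u = pres_class S R v \<longleftrightarrow> pres_eq S R u v"
  using pres_eq.refl[OF assms, of R] unfolding pres_class_def
  by (auto intro: pres_eq.sym pres_eq.trans)

lemma mult_pres_class:
  assumes "set u \<subseteq> S \<times> UNIV" "set v \<subseteq> S \<times> UNIV"
  shows "pres_class S R u \<otimes>\<^bsub>presented_group S R\<^esub> pres_class S R v = pres_class S R (u @ v)"
proof -
  have "pres_class S R (u' @ v') = pres_class S R (u @ v)"
    if "pres_eq S R u u'" "pres_eq S R v v'" for u' v'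
    using pres_eq.append[OF that] assms
    by (subst eq_commute, subst pres_class_eq_iff) auto
  then have "(\<Union>u'\<in>pres_class S R u. \<Union>v'\<in>pres_class S R v. pres_class S R (u' @ v')) =
      (\<Union>u'\<in>pres_class S R u. \<Union>v'\<in>pres_class S R v. pres_class S R (u @ v))"
    by (intro SUP_cong HOL.refl) (simp_all add: pres_class_def)
  moreover have "u \<in> pres_class S R u" "v \<in> pres_class S R v"
    using assms by (simp_all add: pres_class_def pres_eq.refl)
  ultimately show ?thesis
    unfolding presented_group_def by auto
qed

lemma word_inv_in_S: "set u \<subseteq> S \<times> UNIV \<Longrightarrow> set (word_inv u) \<subseteq> S \<times> UNIV"
  by (auto simp: word_inv_def)

lemma word_inv_left:
  "set u \<subseteq> S \<times> UNIV \<Longrightarrow> pres_eq S R (word_inv u @ u) []"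
proof (induction u)
  case Nil
  then show ?case by (simp add: pres_eq.refl)
next
  case (Cons p u)
  obtain x e where p: "p = (x, e)" by fastforce
  have x: "x \<in> S" and u: "set u \<subseteq> S \<times> UNIV"
    using Cons.prems p by auto
  have "pres_eq S R [(x, \<not> e), (x, e)] []"
    using pres_eq.cancel[OF x, of R "\<not> e"] by simp
  then have "pres_eq S R (word_inv u @ [(x, \<not> e), (x, e)] @ u) (word_inv u @ [] @ u)"
    by (intro pres_eq.append pres_eq.refl u word_inv_in_S)
  then have "pres_eq S R (word_inv (p # u) @ p # u) (word_inv u @ u)"
    by (simp add: p)
  then show ?case
    using Cons.IH[OF u] by (rule pres_eq.trans)
qed

lemma carrier_presented_groupE:
  assumes "g \<in> carrier (presented_group S R)"
  obtains u where "g = pres_class S R u" "set u \<subseteq> S \<times> UNIV"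
  using assms by (auto simp: presented_group_def)

lemma pres_class_carrier:
  "set u \<subseteq> S \<times> UNIV \<Longrightarrow> pres_class S R u \<in> carrier (presented_group S R)"
  by (auto simp: presented_group_def)

lemma one_presented_group: "\<one>\<^bsub>presented_group S R\<^esub> = pres_class S R []"
  by (simp add: presented_group_def)

lemma word_inv_mult:
  assumes u: "set u \<subseteq> S \<times> UNIV"
  shows "pres_class S R (word_inv u) \<otimes>\<^bsub>presented_group S R\<^esub> pres_class S R u =
    \<one>\<^bsub>presented_group S R\<^esub>"
  unfolding one_presented_group mult_pres_class[OF word_inv_in_S[OF u] u]
  using word_inv_left[OF u] word_inv_in_S[OF u] u by (subst pres_class_eq_iff) simp_all

lemma group_presented_group: "group (presented_group S R)"
proof (rule groupI)
  fix g h
  assume "g \<in> carrier (presented_group S R)" "h \<in> carrier (presented_group S R)"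
  then obtain u v where "g = pres_class S R u" "set u \<subseteq> S \<times> UNIV"
    "h = pres_class S R v" "set v \<subseteq> S \<times> UNIV"
    by (elim carrier_presented_groupE) blast
  then show "g \<otimes>\<^bsub>presented_group S R\<^esub> h \<in> carrier (presented_group S R)"
    by (simp add: mult_pres_class pres_class_carrier)
next
  fix f g h
  assume "f \<in> carrier (presented_group S R)" "g \<in> carrier (presented_group S R)"
    "h \<in> carrier (presented_group S R)"
  then obtain u v w where "f = pres_class S R u" "set u \<subseteq> S \<times> UNIV"
    "g = pres_class S R v" "set v \<subseteq> S \<times> UNIV" "h = pres_class S R w" "set w \<subseteq> S \<times> UNIV"
    by (elim carrier_presented_groupE) blast
  then show "f \<otimes>\<^bsub>presented_group S R\<^esub> g \<otimes>\<^bsub>presented_group S R\<^esub> h =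
      f \<otimes>\<^bsub>presented_group S R\<^esub> (g \<otimes>\<^bsub>presented_group S R\<^esub> h)"
    by (simp add: mult_pres_class)
next
  fix g
  assume "g \<in> carrier (presented_group S R)"
  then obtain u where u: "g = pres_class S R u" "set u \<subseteq> S \<times> UNIV"
    by (rule carrier_presented_groupE)
  then show "\<one>\<^bsub>presented_group S R\<^esub> \<otimes>\<^bsub>presented_group S R\<^esub> g = g"
    by (simp add: one_presented_group mult_pres_class)
  show "\<exists>h\<in>carrier (presented_group S R). h \<otimes>\<^bsub>presented_group S R\<^esub> g = \<one>\<^bsub>presented_group S R\<^esub>"
    unfolding u(1) using word_inv_mult[OF u(2)] pres_class_carrier[OF word_inv_in_S[OF u(2)]]
    by blast
next
  show "\<one>\<^bsub>presented_group S R\<^esub> \<in> carrier (presented_group S R)"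
    unfolding one_presented_group by (rule pres_class_carrier) simp
qed

lemma inv_pres_class:
  assumes "set u \<subseteq> S \<times> UNIV"
  shows "inv\<^bsub>presented_group S R\<^esub> (pres_class S R u) = pres_class S R (word_inv u)"
  by (rule group.inv_equality[OF group_presented_group word_inv_mult[OF assms]
        pres_class_carrier[OF assms] pres_class_carrier[OF word_inv_in_S[OF assms]]])

lemma additive_on_derived:
  fixes c :: "'a word \<Rightarrow> int"
  assumes append: "\<And>u v. c (u @ v) = c u + c v"
    and cancel: "\<And>x e. x \<in> S \<Longrightarrow> c [(x, e), (x, \<not> e)] = 0"
    and rel: "\<And>u v. (u, v) \<in> R \<Longrightarrow> c u = c v"
    and g: "pres_class S R u \<in> derived (presented_group S R) (carrier (presented_group S R))"
    and u: "set u \<subseteq> S \<times> UNIV"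
  shows "c u = 0"
proof -
  let ?G = "presented_group S R"
  let ?h = "\<lambda>g. the_elem (c ` g)"
  have nil: "c [] = 0"
    using append[of "[]" "[]"] by simp
  have c_eq: "c v = c w" if "pres_eq S R v w" for v w
    using that
  proof (induction rule: pres_eq.induct)
    case (relation u v)
    then show ?case by (rule rel)
  qed (simp_all add: append cancel nil)
  have h: "?h (pres_class S R v) = c v" if "set v \<subseteq> S \<times> UNIV" for v
  proof (rule the_elem_image_unique)
    show "pres_class S R v \<noteq> {}"
      using pres_eq.refl[OF that] by (auto simp: pres_class_def)
    show "c w = c v" if "w \<in> pres_class S R v" for w
      using that by (simp add: c_eq[OF pres_eq.sym] pres_class_def)
  qed
  have hom: "?h \<in> hom ?G integer_group"
  proof (rule homI)
    fix g h
    assume "g \<in> carrier ?G" "h \<in> carrier ?G"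
    then obtain v w where "g = pres_class S R v" "set v \<subseteq> S \<times> UNIV"
      "h = pres_class S R w" "set w \<subseteq> S \<times> UNIV"
      by (elim carrier_presented_groupE) blast
    then show "?h (g \<otimes>\<^bsub>?G\<^esub> h) = ?h g \<otimes>\<^bsub>integer_group\<^esub> ?h h"
      by (simp add: h mult_pres_class append)
  qed simp
  interpret group_hom ?G integer_group ?h
    by (intro group_hom.intro group_hom_axioms.intro group_presented_group group_integer_group hom)
  have "?h ` derived ?G (carrier ?G) = derived integer_group (?h ` carrier ?G)"
    by (rule derived_img[OF order.refl, symmetric])
  also have "\<dots> = {0}"
    using comm_group.derived_eq_singleton[OF abelian_integer_group, of "?h ` carrier ?G"]
    by (simp only: one_integer_group carrier_integer_group subset_UNIV)
  finally have "?h (pres_class S R u) = 0"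
    using imageI[OF g, of ?h] by (simp only: singleton_iff)
  then show ?thesis by (simp add: h u)
qed

end

section \<open>Path chains\<close>

context quandle
begin

lemma inverse_tri_mem: "\<lbrakk>a \<in> X; b \<in> X\<rbrakk> \<Longrightarrow> inverse_tri X (\<triangleleft>) a b \<in> X"
  using bij_translation[of b] unfolding inverse_tri_def bij_betw_def
  by (metis inv_into_into)

lemma tri_inverse_tri: "\<lbrakk>a \<in> X; b \<in> X\<rbrakk> \<Longrightarrow> inverse_tri X (\<triangleleft>) a b \<triangleleft> b = a"
  using bij_translation[of b] unfolding inverse_tri_def bij_betw_def
  by (metis f_inv_into_f)

lemma inverse_tri_tri: "\<lbrakk>a \<in> X; b \<in> X\<rbrakk> \<Longrightarrow> inverse_tri X (\<triangleleft>) (a \<triangleleft> b) b = a"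
  using bij_translation[of b] unfolding inverse_tri_def bij_betw_def
  by (simp add: inv_into_f_f[where f = "\<lambda>x. x \<triangleleft> b"])

fun path_end :: "'a \<Rightarrow> 'a word \<Rightarrow> 'a" where
  "path_end a [] = a"
| "path_end a ((b, e) # w) = path_end (if e then a \<triangleleft> b else inverse_tri X (\<triangleleft>) a b) w"

lemma path_end_append: "path_end a (u @ v) = path_end (path_end a u) v"
  by (induction a u rule: path_end.induct) auto

lemma path_chain_append:
  "path_chain X (\<triangleleft>) a (u @ v) = path_chain X (\<triangleleft>) a u + path_chain X (\<triangleleft>) (path_end a u) v"
proof (induction u arbitrary: a)
  case (Cons p u)
  then show ?case by (cases p; cases "snd p") (auto simp: algebra_simps)
qed simp

text \<open>The boundaries of the steps telescope, so a word that returns to \<open>a\<close> yields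
  a cycle. An inverse letter contributes minus the step that ends, rather than starts, at the
  current point.\<close>

lemma boundary_path_chain:
  assumes "a \<in> X" "set u \<subseteq> X \<times> UNIV"
  shows "rack_boundary (\<triangleleft>) (path_chain X (\<triangleleft>) a u) = frag_of [path_end a u] - frag_of [a]"
  using assms
proof (induction u arbitrary: a)
  case Nil
  then show ?case by (simp add: rack_boundary_def)
next
  case (Cons p u)
  have add: "rack_boundary (\<triangleleft>) (c + d) = rack_boundary (\<triangleleft>) c + rack_boundary (\<triangleleft>) d" for c d
    by (simp add: rack_boundary_def frag_extend_add)
  have diff: "rack_boundary (\<triangleleft>) (c - d) = rack_boundary (\<triangleleft>) c - rack_boundary (\<triangleleft>) d" for c d
    by (simp add: rack_boundary_def frag_extend_diff)
  from Cons show ?case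
    by (cases p; cases "snd p")
      (auto simp: add diff rack_boundary_2 closed inverse_tri_mem tri_inverse_tri)
qed

definition structure_relators :: "('a word \<times> 'a word) set"
  where "structure_relators =
    {([(a, True), (b, True)], [(b, True), (a \<triangleleft> b, True)]) | a b. a \<in> X \<and> b \<in> X}"

lemma structure_group_eq: "structure_group X (\<triangleleft>) = presented_group X structure_relators"
  by (simp add: structure_group_def structure_relators_def)

sublocale presentation X structure_relators
  by unfold_locales (auto simp: structure_relators_def closed)

end

locale quandle_orbit_union = quandle +
  fixes Y :: "'a set"
  assumes Y_subset: "Y \<subseteq> X"
    and Y_closed: "\<lbrakk>a \<in> Y; b \<in> X\<rbrakk> \<Longrightarrow> a \<triangleleft> b \<in> Y"
    and Y_closed_inverse: "\<lbrakk>a \<in> Y; b \<in> X\<rbrakk> \<Longrightarrow> inverse_tri X (\<triangleleft>) a b \<in> Y"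
begin

abbreviation boundaries :: "('a list \<Rightarrow>\<^sub>0 int) set"
  where "boundaries \<equiv> orbit_boundaries_2 X (\<triangleleft>) Y"

sublocale boundaries: frag_subgroup boundaries
  unfolding orbit_boundaries_2_def orbit_chains_def rack_boundary_def
  by (rule frag_subgroup_image)

lemma path_end_mem: "\<lbrakk>a \<in> Y; set u \<subseteq> X \<times> UNIV\<rbrakk> \<Longrightarrow> path_end a u \<in> Y"
  by (induction u arbitrary: a) (auto simp: Y_closed Y_closed_inverse)

lemma boundary_3_mem:
  assumes "a \<in> Y" "b \<in> X" "c \<in> X"
  shows "frag_of [a \<triangleleft> b, c] - frag_of [a, c] - frag_of [a \<triangleleft> c, b \<triangleleft> c] + frag_of [a, b] \<in> boundaries"
  unfolding orbit_boundaries_2_def orbit_chains_def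
  using assms Y_subset
  by (intro image_eqI[where x = "frag_of [a, b, c]"]) (auto simp: tuples_def rack_boundary_3)

text \<open>Well-definedness of the path map. For a structure relation the two chains differ by
  exactly the boundary of the triple \<open>[a, b, c]\<close>, and the end points agree by
  self-distributivity. End points are carried along because the second half of a concatenation
  starts where the first one ends.\<close>

lemma path_chain_pres_eq:
  assumes "pres_eq X structure_relators u v" "a \<in> Y"
  shows "path_end a u = path_end a v \<and>
    path_chain X (\<triangleleft>) a u - path_chain X (\<triangleleft>) a v \<in> boundaries"
  using assms
proof (induction arbitrary: a rule: pres_eq.induct)
  case (refl u)
  then show ?case by (simp add: boundaries.zero_mem)
next
  case (sym u v)
  then show ?case using boundaries.uminus_mem by fastforce
next
  case (trans u v w)
  then show ?case using boundaries.add_mem by fastforce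
next
  case (append u u' v v')
  have "path_end a u \<in> Y"
    using append pres_eq_in_S path_end_mem by blast
  with append show ?case
    using boundaries.add_mem[OF append.IH(1)[THEN conjunct2] append.IH(2)[THEN conjunct2], of a "path_end a u"]
    by (auto simp: path_end_append path_chain_append algebra_simps)
next
  case (cancel x e)
  then show ?case
    using Y_subset by (cases e) (auto simp: tri_inverse_tri inverse_tri_tri boundaries.zero_mem)
next
  case (relation u v)
  then obtain b c where "u = [(b, True), (c, True)]" "v = [(c, True), (b \<triangleleft> c, True)]"
    and bc: "b \<in> X" "c \<in> X"
    by (auto simp: structure_relators_def)
  then show ?case
    using boundary_3_mem[OF \<open>a \<in> Y\<close> bc] self_distrib[OF _ bc] Y_subset \<open>a \<in> Y\<close>
    by (auto simp: algebra_simps)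
qed

lemma path_map_pres_class:
  assumes "a \<in> Y" "set u \<subseteq> X \<times> UNIV"
  shows "path_map X (\<triangleleft>) Y a (pres_class X structure_relators u) =
    boundaries #>\<^bsub>orbit_chains X Y 2\<^esub> path_chain X (\<triangleleft>) a u"
proof -
  have coset: "boundaries #>\<^bsub>orbit_chains X Y 2\<^esub> path_chain X (\<triangleleft>) a v =
      boundaries #>\<^bsub>orbit_chains X Y 2\<^esub> path_chain X (\<triangleleft>) a u"
    if "v \<in> pres_class X structure_relators u" for v
    unfolding orbit_chains_def
    using path_chain_pres_eq[OF pres_eq.sym assms(1), of u v] that[unfolded pres_class_def]
    by (simp add: boundaries.r_coset_eq_iff)
  have "path_map X (\<triangleleft>) Y a (pres_class X structure_relators u) =
      (\<Union>w\<in>pres_class X structure_relators u.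
        boundaries #>\<^bsub>orbit_chains X Y 2\<^esub> path_chain X (\<triangleleft>) a u)"
    unfolding path_map_def by (intro SUP_cong HOL.refl coset)
  moreover have "u \<in> pres_class X structure_relators u"
    using assms by (simp add: pres_class_def pres_eq.refl)
  ultimately show ?thesis
    by auto
qed

lemma path_chain_keys:
  "\<lbrakk>a \<in> Y; set u \<subseteq> X \<times> UNIV\<rbrakk> \<Longrightarrow>
    Poly_Mapping.keys (path_chain X (\<triangleleft>) a u) \<subseteq> {xs \<in> tuples X 2. hd xs \<in> Y}"
proof (induction u arbitrary: a)
  case (Cons p u)
  obtain b e where p: "p = (b, e)" by fastforce
  have b: "b \<in> X" and u: "set u \<subseteq> X \<times> UNIV"
    using Cons.prems p by auto
  let ?a = "if e then a \<triangleleft> b else inverse_tri X (\<triangleleft>) a b"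
  let ?s = "if e then frag_of [a, b] else - frag_of [inverse_tri X (\<triangleleft>) a b, b]"
  have "Poly_Mapping.keys (path_chain X (\<triangleleft>) ?a u) \<subseteq> {xs \<in> tuples X 2. hd xs \<in> Y}"
    using Cons.prems(1) b by (intro Cons.IH u) (simp add: Y_closed Y_closed_inverse)
  moreover have "Poly_Mapping.keys ?s \<subseteq> {xs \<in> tuples X 2. hd xs \<in> Y}"
    using Y_closed_inverse[OF Cons.prems(1) b] Cons.prems(1) b Y_subset
    by (auto simp: tuples_def)
  moreover have "path_chain X (\<triangleleft>) a (p # u) = ?s + path_chain X (\<triangleleft>) ?a u"
    by (cases e) (simp_all add: p)
  ultimately show ?case
    using keys_add[of ?s "path_chain X (\<triangleleft>) ?a u"] by (simp only:) blast
qed simp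

end

section \<open>The second homology of the quandles U\<close>

text \<open>Points are named by arbitrary integers and reduced on construction, so that shifts and
  inductions along an orbit run over all integers without wrap-around cases.\<close>

definition U_elem :: "(nat \<Rightarrow> nat) \<Rightarrow> nat \<Rightarrow> int \<Rightarrow> nat \<times> int"
  where "U_elem n i x = (i, x mod int (n i))"

lemma fst_U_elem [simp]: "fst (U_elem n i x) = i"
  by (simp add: U_elem_def)

lemma U_elem_eq_iff: "U_elem n i x = U_elem n j y \<longleftrightarrow> i = j \<and> x mod int (n i) = y mod int (n i)"
  by (auto simp: U_elem_def)

lemma U_tri_elem: "U_tri n (U_elem n i x) (U_elem n j y) = U_elem n i (x + of_bool (i \<noteq> j))"
  by (auto simp: U_elem_def mod_add_left_eq)

section \<open>Quandle axioms for U and notation for its 2-chains\<close>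

locale U_setup =
  fixes r :: nat and n :: "nat \<Rightarrow> nat"
  assumes r_ge_3: "r \<ge> 3"
    and n_pos: "i \<in> {1..r} \<Longrightarrow> n i \<ge> 1"
begin

abbreviation X :: "(nat \<times> int) set"
  where "X \<equiv> U_quandle r n"

abbreviation el :: "nat \<Rightarrow> int \<Rightarrow> nat \<times> int"
  where "el \<equiv> U_elem n"

lemma el_in_orbit_iff: "i \<in> {1..r} \<Longrightarrow> el i x \<in> U_orbit n j \<longleftrightarrow> i = j"
  using n_pos by (fastforce simp: U_orbit_def U_elem_def carrier_integer_mod_group)

lemma el_in_X: "i \<in> {1..r} \<Longrightarrow> el i x \<in> X"
  using el_in_orbit_iff by (auto simp: U_quandle_def)

lemma U_orbitE:
  assumes "p \<in> U_orbit n i" "i \<in> {1..r}"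
  obtains x where "p = el i x" "0 \<le> x" "x < int (n i)"
  using assms n_pos[OF assms(2)] by (force simp: U_orbit_def U_elem_def carrier_integer_mod_group)

lemma X_E:
  assumes "p \<in> X"
  obtains i x where "p = el i x" "i \<in> {1..r}" "0 \<le> x" "x < int (n i)"
  using assms by (auto simp: U_quandle_def elim!: U_orbitE)

lemma bij_U_tri:
  assumes "b \<in> X"
  shows "bij_betw (\<lambda>a. U_tri n a b) X X"
proof -
  obtain j y where b: "b = el j y" "j \<in> {1..r}"
    using assms by (rule X_E)
  show ?thesis
  proof (rule bij_betw_byWitness[where f' = "\<lambda>(i, x). (i, (x - of_bool (i \<noteq> j)) mod int (n i))"])
    show "\<forall>a\<in>X. (case U_tri n a b of (i, x) \<Rightarrow> (i, (x - of_bool (i \<noteq> j)) mod int (n i))) = a"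
      by (auto simp: b U_tri_elem elim!: X_E) (auto simp: U_elem_def mod_diff_left_eq)
    show "\<forall>a\<in>X. U_tri n (case a of (i, x) \<Rightarrow> (i, (x - of_bool (i \<noteq> j)) mod int (n i))) b = a"
      by (auto simp: b U_elem_def mod_add_left_eq mod_diff_left_eq mod_simps elim!: X_E)
    show "(\<lambda>a. U_tri n a b) ` X \<subseteq> X"
      by (auto simp: b U_tri_elem el_in_X elim!: X_E)
    show "(\<lambda>(i, x). (i, (x - of_bool (i \<noteq> j)) mod int (n i))) ` X \<subseteq> X"
      using el_in_X by (auto simp: U_elem_def elim!: X_E)
  qed
qed

sublocale finite_abelian_quandle X "U_tri n"
proof
  show "finite X"
    using n_pos by (force simp: U_quandle_def U_orbit_def carrier_integer_mod_group)
qed (auto simp: U_tri_elem el_in_X bij_U_tri algebra_simps elim!: X_E)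

lemma inverse_tri_el:
  assumes "i \<in> {1..r}" "j \<in> {1..r}"
  shows "inverse_tri X (U_tri n) (el i x) (el j y) = el i (x - of_bool (i \<noteq> j))"
  using inverse_tri_tri[OF el_in_X[OF assms(1)] el_in_X[OF assms(2)], of "x - of_bool (i \<noteq> j)" y]
  by (simp add: U_tri_elem)

lemma quandle_orbit_union_U_orbit:
  assumes i: "i \<in> {1..r}"
  shows "quandle_orbit_union X (U_tri n) (U_orbit n i)"
proof
  show "U_orbit n i \<subseteq> X"
    using i by (auto simp: U_quandle_def)
  show "U_tri n a b \<in> U_orbit n i" "inverse_tri X (U_tri n) a b \<in> U_orbit n i"
    if "a \<in> U_orbit n i" "b \<in> X" for a b
    using that i
    by (auto simp: U_tri_elem inverse_tri_el el_in_orbit_iff elim!: X_E U_orbitE)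
qed

text \<open>This will be the order of \<open>tors i\<close> modulo boundaries
  (\<open>tors_coset_eq_iff\<close>); the value 1 for more than three orbits expresses that the
  class vanishes.\<close>

definition modulus :: nat
  where "modulus = (if r = 3 then gcd (Gcd (n ` {1..r})) 2 else 1)"

text \<open>The distinguished column outside orbit \<open>i\<close> with which all remaining columns
  are compared.\<close>

definition pivot :: "nat \<Rightarrow> nat"
  where "pivot i = (if i = 1 then 2 else 1)"

lemma pivot: "pivot i \<in> {1..r}" "pivot i \<noteq> i"
  using r_ge_3 by (auto simp: pivot_def)

definition pair :: "nat \<Rightarrow> int \<Rightarrow> nat \<Rightarrow> int \<Rightarrow> (nat \<times> int) list \<Rightarrow>\<^sub>0 int"
  where "pair i x j y = frag_of [el i x, el j y]"

text \<open>The element \<open>e_i\<close> of the overview, represented in the own column of orbit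
  \<open>i\<close>, where every single pair is already a cycle.\<close>

definition tors :: "nat \<Rightarrow> (nat \<times> int) list \<Rightarrow>\<^sub>0 int"
  where "tors i = pair i 1 i 0 - pair i 0 i 0"

abbreviation bd :: "nat \<Rightarrow> ((nat \<times> int) list \<Rightarrow>\<^sub>0 int) set"
  where "bd i \<equiv> orbit_boundaries_2 X (U_tri n) (U_orbit n i)"

lemma pair_periodic: "pair i (x + int (n i)) j y = pair i x j y" "pair i x j (y + int (n j)) = pair i x j y"
  by (simp_all add: pair_def U_elem_def)

end

section \<open>Relations between pairs whose first entry lies in a fixed orbit\<close>

locale U_orbit_setup = U_setup +
  fixes i :: nat
  assumes i: "i \<in> {1..r}"
begin

sublocale orb: quandle_orbit_union X "U_tri n" "U_orbit n i"
  by (rule quandle_orbit_union_U_orbit[OF i])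

lemma rel:
  assumes "j \<in> {1..r}" "k \<in> {1..r}"
  shows "pair i (x + of_bool (i \<noteq> j)) k z - pair i x k z
    - pair i (x + of_bool (i \<noteq> k)) j (y + of_bool (j \<noteq> k)) + pair i x j y \<in> bd i"
  using orb.boundary_3_mem[of "el i x" "el j y" "el k z"] i assms
  by (simp add: el_in_orbit_iff el_in_X U_tri_elem pair_def)

text \<open>For a triple with second entry in orbit \<open>i\<close> and third entry in the pivot
  orbit, the two pivot terms of the boundary cancel and a diagonal move in the own column
  remains.\<close>

lemma rel_own_shift: "pair i (x + 1) i (y + 1) - pair i x i y \<in> bd i"
  using orb.boundaries.uminus_mem[OF rel[of i "pivot i" x 0 y]] i pivot[of i] by simp

lemma rel_own_diagonal: "pair i (x + m) i (y + m) - pair i x i y \<in> bd i"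
proof -
  have "pair i (x + (k + 1)) i (y + (k + 1)) - pair i (x + k) i (y + k) - 0 \<in> bd i" for k
    using rel_own_shift[of "x + k" "y + k"] by (simp add: add.assoc)
  from orb.boundaries.progression[of "\<lambda>m. pair i (x + m) i (y + m)", OF this]
  show ?thesis by simp
qed

text \<open>A separation of variables: the first increment contains \<open>z\<close> and the second
  one \<open>j\<close> and \<open>y\<close>, so modulo boundaries both depend on \<open>x\<close>
  alone.\<close>

lemma rel_mixed:
  assumes "j \<in> {1..r}" "j \<noteq> i"
  shows "pair i (x + 1) i z - pair i x i z - (pair i x j (y + 1) - pair i x j y) \<in> bd i"
  using rel[of j i x z y] i assms by (simp add: algebra_simps)

text \<open>By \<open>rel_mixed\<close> the increment does not change when \<open>z\<close> is
  replaced by \<open>x\<close>; a diagonal move then carries it to the base point, which removes the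
  dependence on \<open>x\<close>.\<close>

lemma own_first: "pair i (x + 1) i z - pair i x i z - tors i \<in> bd i"
proof -
  have "pair i (x + 1) i z - pair i x i z - (pair i (x + 1) i x - pair i x i x) \<in> bd i"
    using orb.boundaries.diff_mem[OF rel_mixed[OF pivot, of x z 0] rel_mixed[OF pivot, of x x 0]]
    by simp
  moreover have "(pair i (1 + x) i (0 + x) - pair i 1 i 0) - (pair i (0 + x) i (0 + x) - pair i 0 i 0) \<in> bd i"
    by (intro orb.boundaries.diff_mem rel_own_diagonal)
  ultimately show ?thesis
    using orb.boundaries.add_mem unfolding tors_def by (fastforce simp: algebra_simps)
qed

lemma other_second:
  assumes "j \<in> {1..r}" "j \<noteq> i"
  shows "pair i x j (y + 1) - pair i x j y - tors i \<in> bd i"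
  using orb.boundaries.diff_mem[OF own_first rel_mixed[OF assms], of x 0 x 0 y]
  by (simp add: algebra_simps)

lemma own_normal_form: "pair i x i y - pair i 0 i 0 - frag_cmul (x - y) (tors i) \<in> bd i"
  using orb.boundaries.add_mem[OF rel_own_diagonal[of "x - y" y 0]
      orb.boundaries.progression[of "\<lambda>x. pair i x i 0", OF own_first, of "x - y"]]
  by (simp add: algebra_simps)

lemma other_normal_form:
  assumes "j \<in> {1..r}" "j \<noteq> i"
  shows "pair i x j y - pair i x j 0 - frag_cmul y (tors i) \<in> bd i"
  using orb.boundaries.progression[of "\<lambda>y. pair i x j y", OF other_second[OF assms]] .

text \<open>The boundary of a triple from three different orbits also shifts the second entry in
  column \<open>j\<close>. Undoing that shift by \<open>other_second\<close> costs one
  \<open>tors i\<close>, and this asymmetry between \<open>j\<close> and \<open>k\<close> is the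
  source of the torsion.\<close>

lemma rel_distinct:
  assumes "j \<in> {1..r}" "j \<noteq> i" "k \<in> {1..r}" "k \<noteq> i" "j \<noteq> k"
  shows "(pair i (x + 1) k 0 - pair i x k 0) - (pair i (x + 1) j 0 - pair i x j 0) - tors i \<in> bd i"
  using orb.boundaries.add_mem[OF rel[of j k x 0 0] other_second[of j "x + 1" 0]] assms
  by (simp add: algebra_simps)

lemma other_first:
  assumes "j \<in> {1..r}" "j \<noteq> i" "k \<in> {1..r}" "k \<noteq> i" "j \<noteq> k"
  shows "(pair i x k 0 - pair i x j 0) - (pair i 0 k 0 - pair i 0 j 0) - frag_cmul x (tors i) \<in> bd i"
  by (rule orb.boundaries.progression[of "\<lambda>x. pair i x k 0 - pair i x j 0"])
    (use rel_distinct[OF assms] in \<open>simp add: algebra_simps\<close>)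

lemma n_tors:
  assumes "j \<in> {1..r}"
  shows "frag_cmul (int (n j)) (tors i) \<in> bd i"
proof (cases "j = i")
  case True
  then show ?thesis
    using orb.boundaries.uminus_mem[OF own_normal_form[of "int (n i)" 0]]
      pair_periodic(1)[of i 0 i 0] by simp
next
  case False
  then show ?thesis
    using orb.boundaries.uminus_mem[OF other_normal_form[OF assms False, of 0 "int (n j)"]]
      pair_periodic(2)[of i 0 j 0] by simp
qed

lemma two_others:
  obtains j k where "j \<in> {1..r}" "j \<noteq> i" "k \<in> {1..r}" "k \<noteq> i" "j \<noteq> k"
proof
  show "pivot i \<in> {1..r}" "pivot i \<noteq> i" by (rule pivot)+
  show "(if i = 3 then 2 else 3) \<in> {1..r}" "(if i = 3 then 2 else 3) \<noteq> i"
    "pivot i \<noteq> (if i = 3 then 2 else 3)"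
    using r_ge_3 by (auto simp: pivot_def)
qed

lemma two_tors: "frag_cmul 2 (tors i) \<in> bd i"
proof -
  obtain j k where jk: "j \<in> {1..r}" "j \<noteq> i" "k \<in> {1..r}" "k \<noteq> i" "j \<noteq> k"
    by (rule two_others)
  show ?thesis
    using orb.boundaries.uminus_mem[OF orb.boundaries.add_mem[OF rel_distinct[OF jk, of 0]
        rel_distinct[OF jk(3,4,1,2) jk(5)[symmetric], of 0]]]
      frag_cmul_distrib[of 1 1 "tors i"]
    by simp
qed

text \<open>With four orbits, the three differences that the relations equate up to the torsion
  element form a cycle of odd length, so that the element itself vanishes.\<close>

lemma tors_mem:
  assumes "r \<ge> 4"
  shows "tors i \<in> bd i"
proof -
  obtain j k where jk: "j \<in> {1..r}" "j \<noteq> i" "k \<in> {1..r}" "k \<noteq> i" "j \<noteq> k"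
    by (rule two_others)
  have "card {i, j, k} < card {1..r}"
    using assms by (simp add: card_insert_if)
  then obtain l where l: "l \<in> {1..r}" "l \<noteq> i" "l \<noteq> j" "l \<noteq> k"
    by (metis card_mono finite.emptyI finite_insert insertCI linorder_not_less subsetI)
  have "frag_cmul 3 (tors i) \<in> bd i"
    using orb.boundaries.uminus_mem[OF orb.boundaries.add_mem[OF orb.boundaries.add_mem[OF
        rel_distinct[OF jk, of 0]
        rel_distinct[OF jk(3,4) l(1,2) l(4)[symmetric], of 0]]
        rel_distinct[OF l(1,2) jk(1,2) l(3), of 0]]]
      frag_cmul_distrib[of 1 1 "tors i"] frag_cmul_distrib[of 2 1 "tors i"]
    by (simp add: algebra_simps)
  then show ?thesis
    using orb.boundaries.diff_mem[OF _ two_tors] frag_cmul_diff_distrib[of 3 2 "tors i"] by force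
qed

lemma modulus_tors: "frag_cmul (int modulus) (tors i) \<in> bd i"
proof (cases "r = 3")
  case True
  have "frag_cmul (gcd (int (Gcd (n ` {1..r}))) 2) (tors i) \<in> bd i"
    by (intro orb.boundaries.gcd_cmul_mem orb.boundaries.Gcd_cmul_mem n_tors two_tors) auto
  moreover have "int modulus = gcd (int (Gcd (n ` {1..r}))) 2"
    unfolding modulus_def if_P[OF True] by (simp add: gcd_int_def)
  ultimately show ?thesis by simp
next
  case False
  then show ?thesis
    using tors_mem r_ge_3 by (simp add: modulus_def)
qed

end

section \<open>Functionals on 2-chains, their invariance, and the normal form\<close>

lemma rack_boundary_simps:
  "rack_boundary t 0 = 0"
  "rack_boundary t (u + v) = rack_boundary t u + rack_boundary t v"
  "rack_boundary t (u - v) = rack_boundary t u - rack_boundary t v"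
  by (simp_all add: rack_boundary_def frag_extend_add frag_extend_diff)

lemma rack_boundary_sum: "rack_boundary t (sum u I) = (\<Sum>i\<in>I. rack_boundary t (u i))"
  by (induction I rule: infinite_finite_induct) (auto simp: rack_boundary_simps)

context U_setup
begin

definition cnt :: "nat \<Rightarrow> nat \<Rightarrow> ((nat \<times> int) list \<Rightarrow>\<^sub>0 int) \<Rightarrow> int"
  where "cnt i j = frag_eval (\<lambda>xs. of_bool (fst (xs ! 0) = i \<and> fst (xs ! 1) = j))"

text \<open>Only pairs with second entry outside orbit \<open>i\<close> move their first entry.
  \<open>wgt i x\<close> counts those that leave \<open>el i x\<close>, and this is all that
  \<open>rack_boundary\<close> sees of a chain (\<open>lookup_rack_boundary\<close>).\<close>

definition wgt :: "nat \<Rightarrow> int \<Rightarrow> ((nat \<times> int) list \<Rightarrow>\<^sub>0 int) \<Rightarrow> int"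
  where "wgt i x = frag_eval (\<lambda>xs. of_bool (xs ! 0 = el i x \<and> fst (xs ! 1) \<noteq> i))"

text \<open>The coefficient of \<open>tors i\<close> in the normal form; only its class modulo \<open>modulus\<close> is invariant.\<close>

definition tor :: "nat \<Rightarrow> ((nat \<times> int) list \<Rightarrow>\<^sub>0 int) \<Rightarrow> int"
  where "tor i = frag_eval (\<lambda>xs. if fst (xs ! 0) = i
    then if fst (xs ! 1) = i then snd (xs ! 0) - snd (xs ! 1)
      else if fst (xs ! 1) = pivot i then snd (xs ! 1)
      else snd (xs ! 0) + snd (xs ! 1)
    else 0)"

lemma coordinate_simps:
  "cnt i j 0 = 0"
  "cnt i j (u + v) = cnt i j u + cnt i j v"
  "cnt i j (u - v) = cnt i j u - cnt i j v"
  "cnt i j (frag_cmul k u) = k * cnt i j u"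
  "cnt i j (sum f I) = (\<Sum>s\<in>I. cnt i j (f s))"
  "wgt i x 0 = 0"
  "wgt i x (u + v) = wgt i x u + wgt i x v"
  "wgt i x (u - v) = wgt i x u - wgt i x v"
  "wgt i x (frag_cmul k u) = k * wgt i x u"
  "wgt i x (sum f I) = (\<Sum>s\<in>I. wgt i x (f s))"
  "tor i 0 = 0"
  "tor i (u + v) = tor i u + tor i v"
  "tor i (u - v) = tor i u - tor i v"
  "tor i (frag_cmul k u) = k * tor i u"
  "tor i (sum f I) = (\<Sum>s\<in>I. tor i (f s))"
  by (simp_all add: cnt_def wgt_def tor_def)

lemma cnt_pair: "cnt i j (pair a x b y) = of_bool (a = i \<and> b = j)"
  by (simp add: cnt_def pair_def)

lemma wgt_pair: "wgt i x' (pair a x b y) = of_bool (a = i \<and> el i x' = el i x \<and> b \<noteq> i)"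
  by (auto simp: wgt_def pair_def U_elem_eq_iff)

lemma tor_pair: "tor i (pair a x b y) = (if a = i
    then if b = i then x mod int (n i) - y mod int (n i)
      else if b = pivot i then y mod int (n b)
      else x mod int (n i) + y mod int (n b)
    else 0)"
  by (simp add: tor_def pair_def) (simp add: U_elem_def)

lemma tuple_2E:
  assumes "xs \<in> tuples X 2"
  obtains a x b y where "xs = [el a x, el b y]" "a \<in> {1..r}" "b \<in> {1..r}"
    "0 \<le> x" "x < int (n a)" "0 \<le> y" "y < int (n b)"
proof -
  obtain p q where "xs = [p, q]" "p \<in> X" "q \<in> X"
    using assms by (auto simp: tuples_def numeral_2_eq_2 length_Suc_conv)
  then show ?thesis
    by (elim X_E) (auto intro: that)
qed

lemma pair_keys:
  "\<lbrakk>a \<in> {1..r}; b \<in> {1..r}\<rbrakk> \<Longrightarrow> Poly_Mapping.keys (pair a x b y) \<subseteq> tuples X 2"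
  by (simp add: pair_def tuples_def el_in_X)

abbreviation bds :: "((nat \<times> int) list \<Rightarrow>\<^sub>0 int) set"
  where "bds \<equiv> rack_boundary (U_tri n) ` carrier (rack_chains X 3)"

sublocale bds: frag_subgroup bds
  unfolding rack_chains_def rack_boundary_def by (rule frag_subgroup_image)

lemma bd_subset_bds: "bd i \<subseteq> bds"
  unfolding orbit_boundaries_2_def orbit_chains_def rack_chains_def
  by (intro image_mono) auto

text \<open>A property stable under differences has to be tested only on the four-term boundaries of
  single triples, here written in integer coordinates.\<close>

lemma bds_induct [consumes 1, case_names zero diff gen]:
  assumes "z \<in> bds" "P 0" "\<And>u v. P u \<Longrightarrow> P v \<Longrightarrow> P (u - v)"
    and gen: "\<And>a b c x y z. \<lbrakk>a \<in> {1..r}; b \<in> {1..r}; c \<in> {1..r}\<rbrakk> \<Longrightarrow>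
      P (pair a (x + of_bool (a \<noteq> b)) c z - pair a x c z
        - pair a (x + of_bool (a \<noteq> c)) b (y + of_bool (b \<noteq> c)) + pair a x b y)"
  shows "P z"
proof -
  have "P (rack_boundary (U_tri n) (frag_of xs))" if xs_mem: "xs \<in> tuples X 3" for xs
  proof -
    obtain p q s where xs: "xs = [p, q, s]"
      using xs_mem by (auto simp: tuples_def numeral_3_eq_3 length_Suc_conv)
    moreover have "p \<in> X" "q \<in> X" "s \<in> X"
      using xs_mem by (auto simp: xs tuples_def)
    moreover obtain a x where "p = el a x" "a \<in> {1..r}"
      using \<open>p \<in> X\<close> by (rule X_E)
    moreover obtain b y where "q = el b y" "b \<in> {1..r}"
      using \<open>q \<in> X\<close> by (rule X_E)
    moreover obtain c z where "s = el c z" "c \<in> {1..r}"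
      using \<open>s \<in> X\<close> by (rule X_E)
    ultimately show ?thesis
      using gen[of a b c x z y] by (simp add: rack_boundary_3 U_tri_elem pair_def)
  qed
  then show ?thesis
    using assms(1-3) unfolding rack_chains_def rack_boundary_def
    by (elim frag_extend_image_induct) (auto simp: rack_boundary_def)
qed

lemma cnt_bds: "z \<in> bds \<Longrightarrow> cnt i j z = 0"
  by (induction rule: bds_induct) (simp_all add: coordinate_simps cnt_pair)

text \<open>The four terms of a boundary form two paths from \<open>a\<close> to the same end, one
  acting by \<open>b\<close> and \<open>c\<close>, the other by \<open>c\<close> and the translate
  of \<open>b\<close>. Since translation preserves orbits, both paths leave the same points of orbit
  \<open>i\<close>.\<close>

lemma wgt_bds: "z \<in> bds \<Longrightarrow> wgt i x z = 0"
proof (induction rule: bds_induct)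
  case (gen a b c x y z)
  then show ?case
    by (cases "a = i"; cases "b = i"; cases "c = i") (simp_all add: coordinate_simps wgt_pair)
qed (simp_all add: coordinate_simps)

lemma rack_boundary_pair:
  "rack_boundary (U_tri n) (pair a x b y) = frag_of [el a (x + of_bool (a \<noteq> b))] - frag_of [el a x]"
  by (simp add: pair_def rack_boundary_2 U_tri_elem)

lemma rack_boundary_bds: "z \<in> bds \<Longrightarrow> rack_boundary (U_tri n) z = 0"
  by (induction rule: bds_induct) (auto simp: rack_boundary_simps rack_boundary_pair algebra_simps)

lemma modulus_dvd_n: "a \<in> {1..r} \<Longrightarrow> modulus dvd n a"
  unfolding modulus_def by (auto intro: dvd_trans[OF gcd_dvd1] Gcd_dvd)

lemma modulus_cases: "modulus = 1 \<or> modulus = 2 \<and> r = 3"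
proof -
  have "g = 1 \<or> g = 2" if "g dvd 2" for g :: nat
    using dvd_imp_le[OF that] that by (cases g) auto
  then have "gcd (Gcd (n ` {1..r})) 2 = 1 \<or> gcd (Gcd (n ` {1..r})) 2 = 2"
    by (meson gcd_dvd2)
  then show ?thesis
    unfolding modulus_def by metis
qed

text \<open>With all orbit lengths even, reduction modulo \<open>n a\<close> preserves parity, so
  the residues and signs in \<open>tor\<close> disappear.\<close>

lemma even_tor_pair:
  assumes "\<And>a. a \<in> {1..r} \<Longrightarrow> even (n a)" "a \<in> {1..r}" "b \<in> {1..r}"
  shows "even (tor i (pair a x b y)) \<longleftrightarrow> a \<noteq> i \<or> (if b = pivot i then even y else even (x + y))"
  using assms pivot(2)[of i] by (auto simp: tor_pair dvd_mod_iff)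

text \<open>Only \<open>modulus = 2\<close> needs work. Then \<open>r = 3\<close> and all
  \<open>n a\<close> are even, so a finite check over the orbits of a triple remains. It succeeds
  because there is just one column besides \<open>i\<close> and the pivot: in it a step of the first
  entry changes the parity of \<open>tor i\<close>, in the pivot column it does not.\<close>

lemma modulus_dvd_tor:
  assumes "z \<in> bds" "i \<in> {1..r}"
  shows "int modulus dvd tor i z"
proof (cases "modulus = 1")
  case False
  then have modulus: "modulus = 2" and r: "r = 3"
    using modulus_cases by auto
  have n: "even (n a)" if "a \<in> {1..r}" for a
    using modulus_dvd_n[OF that] modulus by simp
  from assms(1) have "even (tor i z)"
  proof (induction rule: bds_induct)
    case (gen a b c x y z)
    have "pivot i = (if i = 1 then 2 else 1)"
      by (rule pivot_def)
    moreover have "i \<in> {1, 2, 3}" "a \<in> {1, 2, 3}" "b \<in> {1, 2, 3}" "c \<in> {1, 2, 3}"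
      using gen assms(2) r by auto
    ultimately show ?case
      using gen even_tor_pair[OF n, of a c i _ z]
         even_tor_pair[OF n, of a b i]
      by (simp add: coordinate_simps) auto
  qed (auto simp: coordinate_simps)
  then show ?thesis
    by (simp add: modulus)
qed simp

text \<open>Every pair that leaves its first entry is moved to the pivot column with that entry
  kept, so the third sum uses \<open>wgt\<close>, which counts all columns other than
  \<open>i\<close> together. The second sum records, at first entry 0, from which column the pair
  came. The own column collapses to its base point.\<close>

definition normal_form :: "nat \<Rightarrow> ((nat \<times> int) list \<Rightarrow>\<^sub>0 int) \<Rightarrow> (nat \<times> int) list \<Rightarrow>\<^sub>0 int"
  where "normal_form i z = frag_cmul (cnt i i z) (pair i 0 i 0)
    + (\<Sum>k\<in>{1..r} - {i, pivot i}. frag_cmul (cnt i k z) (pair i 0 k 0 - pair i 0 (pivot i) 0))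
    + (\<Sum>x\<in>{0..<int (n i)}. frag_cmul (wgt i x z) (pair i x (pivot i) 0))
    + frag_cmul (tor i z) (tors i)"

lemma normal_form_diff: "normal_form i (u - v) = normal_form i u - normal_form i v"
  unfolding normal_form_def coordinate_simps frag_cmul_diff_distrib sum_subtractf
  by simp

lemma normal_form_0: "normal_form i 0 = 0"
  using normal_form_diff[of i 0 0] by simp

lemma normal_form_pair_other: "a \<noteq> i \<Longrightarrow> normal_form i (pair a x b y) = 0"
  by (simp add: normal_form_def cnt_pair wgt_pair tor_pair U_elem_eq_iff)

text \<open>The three cases are the branches in the definition of \<open>tor\<close>. The range
  assumptions make \<open>x\<close> and \<open>y\<close> their own residues, so that
  \<open>tor\<close> is literally \<open>x - y\<close>, \<open>y\<close> or
  \<open>x + y\<close>.\<close>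

lemma normal_form_pair:
  assumes i: "i \<in> {1..r}" and j: "j \<in> {1..r}"
    and x: "0 \<le> x" "x < int (n i)" and y: "0 \<le> y" "y < int (n j)"
  shows "pair i x j y - normal_form i (pair i x j y) \<in> bd i"
proof -
  interpret U_orbit_setup r n i
    by unfold_locales (rule i)
  have wgt_sum: "(\<Sum>x'\<in>{0..<int (n i)}. frag_cmul (wgt i x' (pair i x j y)) (pair i x' (pivot i) 0)) =
      pair i x (pivot i) 0" if "j \<noteq> i"
  proof -
    have "(\<Sum>x'\<in>{0..<int (n i)}. frag_cmul (wgt i x' (pair i x j y)) (pair i x' (pivot i) 0)) =
        (\<Sum>x'\<in>{0..<int (n i)}. if x' = x then pair i x' (pivot i) 0 else 0)"
      using that x by (intro sum.cong) (auto simp: wgt_pair U_elem_eq_iff)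
    then show ?thesis using x by simp
  qed
  have cnt_sum: "(\<Sum>k\<in>{1..r} - {i, pivot i}.
      frag_cmul (cnt i k (pair i x j y)) (pair i 0 k 0 - pair i 0 (pivot i) 0)) =
      (if j \<in> {i, pivot i} then 0 else pair i 0 j 0 - pair i 0 (pivot i) 0)"
  proof -
    have "(\<Sum>k\<in>{1..r} - {i, pivot i}.
        frag_cmul (cnt i k (pair i x j y)) (pair i 0 k 0 - pair i 0 (pivot i) 0)) =
        (\<Sum>k\<in>{1..r} - {i, pivot i}. if k = j then pair i 0 k 0 - pair i 0 (pivot i) 0 else 0)"
      by (intro sum.cong) (auto simp: cnt_pair)
    also have "\<dots> = (if j \<in> {i, pivot i} then 0 else pair i 0 j 0 - pair i 0 (pivot i) 0)"
      using j by (subst sum.delta) auto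
    finally show ?thesis .
  qed
  consider "j = i" | "j = pivot i" "j \<noteq> i" | "j \<noteq> pivot i" "j \<noteq> i"
    by blast
  then show ?thesis
  proof cases
    case 1
    have "wgt i x' (pair i x j y) = 0" for x'
      by (simp add: 1 wgt_pair)
    then have "normal_form i (pair i x j y) = pair i 0 i 0 + frag_cmul (x - y) (tors i)"
      using x y 1 by (simp add: normal_form_def cnt_sum[unfolded 1] cnt_pair tor_pair)
    then show ?thesis
      using own_normal_form[of x y] 1 by (simp add: algebra_simps)
  next
    case 2
    then have "normal_form i (pair i x j y) = pair i x j 0 + frag_cmul y (tors i)"
      unfolding normal_form_def wgt_sum[OF 2(2)] cnt_sum
      using y by (simp add: cnt_pair tor_pair)
    then show ?thesis
      using other_normal_form[OF j 2(2), of x y] by (simp add: algebra_simps)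
  next
    case 3
    then have eq: "normal_form i (pair i x j y) =
        pair i 0 j 0 - pair i 0 (pivot i) 0 + pair i x (pivot i) 0 + frag_cmul (x + y) (tors i)"
      unfolding normal_form_def wgt_sum[OF 3(2)] cnt_sum
      using x y by (simp add: cnt_pair tor_pair)
    \<comment> \<open>Moving the second entry to 0 costs \<open>y\<close> copies of
      \<open>tors i\<close>; exchanging column \<open>j\<close> for the pivot at first entry
      \<open>x\<close> instead of 0 costs another \<open>x\<close>.\<close>
    have "(pair i x j y - pair i x j 0 - frag_cmul y (tors i)) +
        ((pair i x j 0 - pair i x (pivot i) 0) - (pair i 0 j 0 - pair i 0 (pivot i) 0)
          - frag_cmul x (tors i)) \<in> bd i"
      using other_first[OF pivot j 3(2) 3(1)[symmetric]] other_normal_form[OF j 3(2)]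
      by (intro orb.boundaries.add_mem)
    then show ?thesis
      unfolding eq by (simp add: algebra_simps frag_cmul_distrib)
  qed
qed

text \<open>The torsion groups live in the quotient of the subcomplex of orbit \<open>i\<close>, so
  the difference has to lie in \<open>bd i\<close> and not merely in \<open>bds\<close>.\<close>

lemma normal_form_orbit:
  assumes i: "i \<in> {1..r}"
    and "Poly_Mapping.keys z \<subseteq> {xs \<in> tuples X 2. hd xs \<in> U_orbit n i}"
  shows "z - normal_form i z \<in> bd i"
proof -
  interpret U_orbit_setup r n i
    by unfold_locales (rule i)
  show ?thesis
    using assms(2)
  proof (induction rule: frag_induction)
    case zero
    then show ?case by (simp add: normal_form_0 orb.boundaries.zero_mem)
  next
    case (one xs)
    then have xs: "xs \<in> tuples X 2" "hd xs \<in> U_orbit n i"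
      by auto
    from xs(1) obtain a x b y where p: "xs = [el a x, el b y]" "a \<in> {1..r}" "b \<in> {1..r}"
      "0 \<le> x" "x < int (n a)" "0 \<le> y" "y < int (n b)"
      by (rule tuple_2E)
    then have "a = i"
      using xs(2) by (simp add: el_in_orbit_iff)
    with p show ?case
      using normal_form_pair[of i b x y] by (simp add: pair_def)
  next
    case (diff u v)
    then show ?case
      using orb.boundaries.diff_mem[OF diff] by (simp add: normal_form_diff algebra_simps)
  qed
qed

lemma normal_form_total:
  assumes "Poly_Mapping.keys z \<subseteq> tuples X 2"
  shows "z - (\<Sum>i\<in>{1..r}. normal_form i z) \<in> bds"
  using assms
proof (induction rule: frag_induction)
  case zero
  then show ?case by (simp add: normal_form_0 bds.zero_mem)
next
  case (one xs)
  then obtain a x b y where p: "xs = [el a x, el b y]" "a \<in> {1..r}" "b \<in> {1..r}"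
    "0 \<le> x" "x < int (n a)" "0 \<le> y" "y < int (n b)"
    by (rule tuple_2E)
  have "(\<Sum>i\<in>{1..r}. normal_form i (pair a x b y)) =
      (\<Sum>i\<in>{1..r}. if i = a then normal_form a (pair a x b y) else 0)"
    by (intro sum.cong) (auto simp: normal_form_pair_other)
  also have "\<dots> = normal_form a (pair a x b y)"
    using p(2) by simp
  finally show ?case
    using normal_form_pair[OF p(2-)] bd_subset_bds[of a] p(1) by (auto simp: pair_def)
next
  case (diff u v)
  then show ?case
    using bds.diff_mem[OF diff] by (simp add: normal_form_diff sum_subtractf algebra_simps)
qed

text \<open>A point gains one from each pair that moves its predecessor onto it and loses one from
  each pair that moves it away.\<close>

lemma lookup_rack_boundary:
  assumes "Poly_Mapping.keys z \<subseteq> tuples X 2"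
  shows "Poly_Mapping.lookup (rack_boundary (U_tri n) z) [el i x] = wgt i (x - 1) z - wgt i x z"
  using assms
proof (induction rule: frag_induction)
  case zero
  then show ?case by (simp add: rack_boundary_simps coordinate_simps)
next
  case (one xs)
  then obtain a u b v where p: "xs = [el a u, el b v]"
    by (rule tuple_2E)
  have "x - (u + 1) = x - 1 - u"
    by simp
  then have shift: "el i x = el i (u + 1) \<longleftrightarrow> el i (x - 1) = el i u"
    unfolding U_elem_eq_iff mod_eq_dvd_iff by (simp only: simp_thms)
  have "Poly_Mapping.lookup (rack_boundary (U_tri n) (pair a u b v)) [el i x] =
      of_bool (el i x = el a (u + of_bool (a \<noteq> b))) - of_bool (el i x = el a u)"
    by (simp add: rack_boundary_pair lookup_minus)
  also have "\<dots> = wgt i (x - 1) (pair a u b v) - wgt i x (pair a u b v)"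
  proof (cases "a = i")
    case True
    then show ?thesis
      by (cases "b = i") (simp_all add: wgt_pair shift)
  next
    case False
    then show ?thesis
      by (simp add: wgt_pair U_elem_eq_iff)
  qed
  finally have "Poly_Mapping.lookup (rack_boundary (U_tri n) (pair a u b v)) [el i x] =
      wgt i (x - 1) (pair a u b v) - wgt i x (pair a u b v)" .
  then show ?case
    by (simp add: p pair_def)
next
  case (diff u v)
  then show ?case
    by (simp add: rack_boundary_simps lookup_minus coordinate_simps)
qed

lemma wgt_cycle:
  assumes "Poly_Mapping.keys z \<subseteq> tuples X 2" "rack_boundary (U_tri n) z = 0"
  shows "wgt i x z = wgt i 0 z"
proof -
  have step: "wgt i (x - 1) z = wgt i x z" for x
    using lookup_rack_boundary[OF assms(1), of i x] assms(2) by simp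
  show ?thesis
  proof (induction x rule: int_induct[where k = 0])
    case (step1 x)
    then show ?case using step[of "x + 1"] by simp
  next
    case (step2 x)
    then show ?case using step[of x] by simp
  qed simp
qed

text \<open>Both sides count the pairs that leave their first entry in orbit \<open>i\<close>, once
  by that entry and once by the orbit of the second entry. For a cycle the weights are all equal, so
  vanishing counts force vanishing weights.\<close>

lemma wgt_total:
  assumes "Poly_Mapping.keys z \<subseteq> tuples X 2"
  shows "(\<Sum>x\<in>{0..<int (n i)}. wgt i x z) = (\<Sum>j\<in>{1..r} - {i}. cnt i j z)"
  using assms
proof (induction rule: frag_induction)
  case zero
  then show ?case by (simp add: coordinate_simps)
next
  case (one xs)
  then obtain a x b y where p: "xs = [el a x, el b y]" "a \<in> {1..r}" "b \<in> {1..r}"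
    "0 \<le> x" "x < int (n a)"
    by (rule tuple_2E)
  have "(\<Sum>x'\<in>{0..<int (n i)}. wgt i x' (pair a x b y)) =
      (\<Sum>x'\<in>{0..<int (n i)}. if x' = x then of_bool (a = i \<and> b \<noteq> i) else 0)"
    using p by (intro sum.cong) (auto simp: wgt_pair U_elem_eq_iff)
  also have "\<dots> = of_bool (a = i \<and> b \<noteq> i)"
    using p by auto
  also have "\<dots> = (\<Sum>j\<in>{1..r} - {i}. if j = b then of_bool (a = i) else 0)"
    using p by (subst sum.delta) auto
  also have "\<dots> = (\<Sum>j\<in>{1..r} - {i}. cnt i j (pair a x b y))"
    by (intro sum.cong) (auto simp: cnt_pair)
  finally show ?case
    by (simp add: p pair_def)
next
  case (diff u v)
  then show ?case by (simp add: coordinate_simps sum_subtractf)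
qed

lemma normal_form_eq_tors:
  assumes "\<And>j. j \<in> {1..r} - {pivot i} \<Longrightarrow> cnt i j z = 0" "\<And>x. wgt i x z = 0" "i \<in> {1..r}"
  shows "normal_form i z = frag_cmul (tor i z) (tors i)"
proof -
  have "cnt i i z = 0"
    using assms(1,3) pivot(2)[of i] by simp
  moreover have "(\<Sum>k\<in>{1..r} - {i, pivot i}.
      frag_cmul (cnt i k z) (pair i 0 k 0 - pair i 0 (pivot i) 0)) = 0"
    using assms(1) by (intro sum.neutral) auto
  ultimately show ?thesis
    unfolding normal_form_def assms(2) by simp
qed

end

lemma (in frag_subgroup) set_mult_r_coset:
  "(B #>\<^bsub>free_Abelian_group S\<^esub> u) <#>\<^bsub>free_Abelian_group S\<^esub> (B #>\<^bsub>free_Abelian_group S\<^esub> v) =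
    B #>\<^bsub>free_Abelian_group S\<^esub> (u + v)"
proof (intro subset_antisym subsetI)
  fix w
  assume "w \<in> (B #>\<^bsub>free_Abelian_group S\<^esub> u) <#>\<^bsub>free_Abelian_group S\<^esub> (B #>\<^bsub>free_Abelian_group S\<^esub> v)"
  then obtain b c where "b \<in> B" "c \<in> B" "w = b + u + (c + v)"
    by (auto simp: r_coset_def set_mult_def)
  moreover from this have "w = (b + c) + (u + v)" "b + c \<in> B"
    by (simp_all add: add_mem)
  ultimately show "w \<in> B #>\<^bsub>free_Abelian_group S\<^esub> (u + v)"
    by (auto simp: r_coset_def)
next
  fix w
  assume "w \<in> B #>\<^bsub>free_Abelian_group S\<^esub> (u + v)"
  then obtain b where "b \<in> B" "w = b + u + (0 + v)"
    by (auto simp: r_coset_def algebra_simps)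
  moreover from this have "b + u \<in> B #>\<^bsub>free_Abelian_group S\<^esub> u"
    "0 + v \<in> B #>\<^bsub>free_Abelian_group S\<^esub> v"
    unfolding r_coset_def mult_free_Abelian_group using zero_mem by blast+
  ultimately show "w \<in> (B #>\<^bsub>free_Abelian_group S\<^esub> u) <#>\<^bsub>free_Abelian_group S\<^esub>
      (B #>\<^bsub>free_Abelian_group S\<^esub> v)"
    unfolding set_mult_def mult_free_Abelian_group by blast
qed

lemma DirProd_trivial_iso:
  assumes "carrier H = {\<one>\<^bsub>H\<^esub>}"
  shows "G \<times>\<times> H \<cong> G"
proof -
  have "fst \<in> iso (G \<times>\<times> H) G"
    using assms by (auto simp: iso_def hom_def bij_betw_def inj_on_def image_iff)
  then show ?thesis by (rule is_isoI)
qed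

section \<open>Coordinates on cycles and the second homology group\<close>

context U_setup
begin

text \<open>On cycles, \<open>wgt i x\<close> does not depend on \<open>x\<close>. It replaces the count of the pivot column, since
  the counts of all columns other than \<open>i\<close> add up to \<open>n i * wgt i 0\<close>.\<close>

definition coord :: "nat \<Rightarrow> nat \<Rightarrow> ((nat \<times> int) list \<Rightarrow>\<^sub>0 int) \<Rightarrow> int"
  where "coord i j z = (if j = pivot i then wgt i 0 z else cnt i j z)"

lemma coord_simps:
  "coord i j (u + v) = coord i j u + coord i j v"
  "coord i j (u - v) = coord i j u - coord i j v"
  "coord i j (frag_cmul k u) = k * coord i j u"
  "coord i j (sum f I) = (\<Sum>s\<in>I. coord i j (f s))"
  by (simp_all add: coord_def coordinate_simps)

text \<open>The basis dual to \<open>coord\<close>. In the pivot column no single pair is a cycle;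
  the full turn of orbit \<open>i\<close> is one, and it has weight 1 at every point.\<close>

definition basic_cycle :: "nat \<Rightarrow> nat \<Rightarrow> (nat \<times> int) list \<Rightarrow>\<^sub>0 int"
  where "basic_cycle i j =
    (if j = pivot i then \<Sum>x<n i. pair i (int x) j 0
     else if j = i then pair i 0 i 0
     else pair i 0 j 0 - pair i 0 (pivot i) 0)"

definition cycles :: "((nat \<times> int) list \<Rightarrow>\<^sub>0 int) set"
  where "cycles = {z. Poly_Mapping.keys z \<subseteq> tuples X 2 \<and> rack_boundary (U_tri n) z = 0}"

sublocale cycles: frag_subgroup cycles
proof
  show "u - v \<in> cycles" if "u \<in> cycles" "v \<in> cycles" for u v
    using that keys_diff[of u v] by (auto simp: cycles_def rack_boundary_simps)
qed (simp add: cycles_def rack_boundary_simps)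

lemma tors_cycle:
  assumes "i \<in> {1..r}"
  shows "tors i \<in> cycles"
proof -
  have "pair i x i 0 \<in> cycles" for x
    using pair_keys[OF assms assms] by (simp add: cycles_def rack_boundary_pair)
  then show ?thesis
    unfolding tors_def by (intro cycles.diff_mem)
qed

lemma basic_cycle_cycle:
  assumes "i \<in> {1..r}" "j \<in> {1..r}"
  shows "basic_cycle i j \<in> cycles"
proof -
  have "Poly_Mapping.keys (\<Sum>x<n i. pair i (int x) j 0) \<subseteq> tuples X 2"
    using keys_sum[of "\<lambda>x. pair i (int x) j 0" "{..<n i}"] pair_keys[OF assms] by blast
  moreover have "rack_boundary (U_tri n) (\<Sum>x<n i. pair i (int x) j 0) = 0" if "j \<noteq> i"
  proof -
    have "rack_boundary (U_tri n) (\<Sum>x<n i. pair i (int x) j 0) =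
        (\<Sum>x<n i. frag_of [el i (int (Suc x))] - frag_of [el i (int x)])"
      using that by (simp add: rack_boundary_sum rack_boundary_pair add.commute)
    also have "\<dots> = frag_of [el i (int (n i))] - frag_of [el i (int 0)]"
      by (rule sum_lessThan_telescope)
    also have "el i (int (n i)) = el i (int 0)"
      by (simp add: U_elem_def)
    finally show ?thesis by simp
  qed
  moreover have "pair i 0 i 0 \<in> cycles"
    using pair_keys[OF assms(1) assms(1)] by (simp add: cycles_def rack_boundary_pair)
  moreover have "pair i 0 j 0 - pair i 0 (pivot i) 0 \<in> cycles" if "j \<noteq> i"
    using that pivot(2)[of i] keys_diff[of "pair i 0 j 0" "pair i 0 (pivot i) 0"]
      pair_keys[OF assms, of 0 0] pair_keys[OF assms(1) pivot(1)[of i], of 0 0]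
    by (auto simp: cycles_def rack_boundary_simps rack_boundary_pair)
  ultimately show ?thesis
    using pivot(2)[of i] by (auto simp: basic_cycle_def cycles_def)
qed

lemma coord_tors: "coord i j (tors k) = 0"
  by (simp add: tors_def coord_simps) (simp add: coord_def wgt_pair cnt_pair)

text \<open>For \<open>n i = 1\<close> the chain \<open>tors i\<close> is literally 0, hence
  \<open>1 mod int (n i)\<close> in place of 1. Modulo \<open>modulus\<close>, a divisor of
  \<open>n i\<close>, this makes no difference.\<close>

lemma tor_tors: "tor i (tors k) = (if i = k then 1 mod int (n i) else 0)"
  by (simp add: tors_def coordinate_simps tor_pair)

lemma coord_basic_cycle:
  assumes "i \<in> {1..r}" "k \<in> {1..r}"
  shows "coord i j (basic_cycle k l) = of_bool (i = k \<and> j = l)"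
proof (cases "i = k")
  case False
  then show ?thesis
    by (simp add: basic_cycle_def coord_simps) (simp add: coord_def wgt_pair cnt_pair)
next
  case True
  have "(\<Sum>x<n i. wgt i 0 (pair i (int x) (pivot i) 0)) = (\<Sum>x<n i. if x = 0 then 1 else 0)"
    using pivot(2)[of i] by (intro sum.cong) (auto simp: wgt_pair U_elem_eq_iff)
  also have "\<dots> = 1"
    using n_pos[OF assms(1)] by simp
  finally show ?thesis
    using True pivot(2)[of i]
    by (simp add: basic_cycle_def coord_simps) (auto simp: coord_def wgt_pair cnt_pair)
qed

lemma tor_basic_cycle: "tor i (basic_cycle k l) = 0"
proof -
  have "tor i (pair k x l 0) = 0" if "l = pivot k" for x
    using that pivot(2)[of k] pivot(2)[of i] by (auto simp: tor_pair)
  then show ?thesis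
    by (auto simp: basic_cycle_def coordinate_simps tor_pair)
qed

lemma cycle_eq_tors:
  assumes "z \<in> cycles" "i \<in> {1..r}" "\<And>j. j \<in> {1..r} \<Longrightarrow> coord i j z = 0"
  shows "normal_form i z = frag_cmul (tor i z) (tors i)"
proof (rule normal_form_eq_tors[OF _ _ assms(2)])
  show "cnt i j z = 0" if "j \<in> {1..r} - {pivot i}" for j
    using assms(3)[of j] that by (simp add: coord_def)
  have "wgt i 0 z = 0"
    using assms(3)[OF pivot(1)[of i]] by (simp add: coord_def)
  then show "wgt i x z = 0" for x
    using wgt_cycle[of z i x] assms(1) by (simp add: cycles_def)
qed

lemma bds_subset_cycles: "bds \<subseteq> cycles"
proof
  fix z assume z: "z \<in> bds"
  then have "Poly_Mapping.keys z \<subseteq> tuples X 2"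
  proof (induction rule: bds_induct)
    case (diff u v)
    then show ?case using keys_diff[of u v] by blast
  next
    case (gen a b c x y z)
    have sub: "Poly_Mapping.keys (u - v) \<subseteq> tuples X 2" "Poly_Mapping.keys (u + v) \<subseteq> tuples X 2"
      if "Poly_Mapping.keys u \<subseteq> tuples X 2" "Poly_Mapping.keys v \<subseteq> tuples X 2" for u v
      using that keys_diff[of u v] keys_add[of u v] by blast+
    show ?case
      by (intro sub pair_keys gen)
  qed simp
  then show "z \<in> cycles"
    using rack_boundary_bds[OF z] by (simp add: cycles_def)
qed

text \<open>Completeness of the invariants. Once the coordinates vanish, each normal form consists
  of \<open>tor i z\<close> copies of \<open>tors i\<close>, and \<open>modulus\<close> copies are a
  boundary.\<close>

lemma cycle_in_bds_iff:
  assumes z: "z \<in> cycles"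
  shows "z \<in> bds \<longleftrightarrow>
    (\<forall>i\<in>{1..r}. (\<forall>j\<in>{1..r}. coord i j z = 0) \<and> int modulus dvd tor i z)"
proof
  assume "z \<in> bds"
  then show "\<forall>i\<in>{1..r}. (\<forall>j\<in>{1..r}. coord i j z = 0) \<and> int modulus dvd tor i z"
    by (simp add: coord_def wgt_bds cnt_bds modulus_dvd_tor)
next
  assume *: "\<forall>i\<in>{1..r}. (\<forall>j\<in>{1..r}. coord i j z = 0) \<and> int modulus dvd tor i z"
  have "normal_form i z \<in> bds" if i: "i \<in> {1..r}" for i
  proof -
    interpret U_orbit_setup r n i
      by unfold_locales (rule i)
    obtain q where q: "tor i z = q * int modulus"
      using * i by (metis dvdE mult.commute)
    have "normal_form i z = frag_cmul q (frag_cmul (int modulus) (tors i))"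
      using cycle_eq_tors[OF z i] * i by (simp add: q[symmetric])
    then show ?thesis
      using orb.boundaries.cmul_mem[OF modulus_tors] bd_subset_bds[of i] by auto
  qed
  then have "(\<Sum>i\<in>{1..r}. normal_form i z) \<in> bds"
    by (intro bds.sum_mem)
  moreover have "z - (\<Sum>i\<in>{1..r}. normal_form i z) \<in> bds"
    using z by (intro normal_form_total) (simp add: cycles_def)
  ultimately have "z - (\<Sum>i\<in>{1..r}. normal_form i z) + (\<Sum>i\<in>{1..r}. normal_form i z) \<in> bds"
    by (intro bds.add_mem)
  then show "z \<in> bds"
    by simp
qed

text \<open>Independence of the invariants. The basic cycles carry the integer coordinates and have
  \<open>tor\<close> zero, while \<open>tors i\<close> has all integer coordinates zero; hence both
  kinds can be prescribed separately.\<close>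

lemma cycle_with_coordinates:
  fixes f :: "nat \<Rightarrow> nat \<Rightarrow> int" and g :: "nat \<Rightarrow> int"
  obtains z where "z \<in> cycles" "\<And>i j. \<lbrakk>i \<in> {1..r}; j \<in> {1..r}\<rbrakk> \<Longrightarrow> coord i j z = f i j"
    "\<And>i. i \<in> {1..r} \<Longrightarrow> tor i z mod int modulus = g i mod int modulus"
proof
  let ?z = "\<Sum>i\<in>{1..r}. (\<Sum>j\<in>{1..r}. frag_cmul (f i j) (basic_cycle i j)) + frag_cmul (g i) (tors i)"
  show "?z \<in> cycles"
    by (intro cycles.sum_mem cycles.add_mem cycles.cmul_mem basic_cycle_cycle tors_cycle)
  show "coord i j ?z = f i j" if "i \<in> {1..r}" "j \<in> {1..r}" for i j
  proof -
    have "coord i j ?z = (\<Sum>k\<in>{1..r}. \<Sum>l\<in>{1..r}. f k l * of_bool (i = k \<and> j = l))"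
      unfolding coord_simps coord_tors
      using that by (intro sum.cong) (auto simp: coord_basic_cycle)
    also have "\<dots> = (\<Sum>k\<in>{1..r}. if k = i then f i j else 0)"
    proof (rule sum.cong[OF HOL.refl])
      fix k
      have "(\<Sum>l\<in>{1..r}. f k l * of_bool (i = k \<and> j = l)) =
          (\<Sum>l\<in>{1..r}. if l = j then (if k = i then f i j else 0) else 0)"
        by (intro sum.cong) auto
      then show "(\<Sum>l\<in>{1..r}. f k l * of_bool (i = k \<and> j = l)) = (if k = i then f i j else 0)"
        using that(2) by simp
    qed
    finally show ?thesis
      using that(1) by simp
  qed
  show "tor i ?z mod int modulus = g i mod int modulus" if "i \<in> {1..r}" for i
  proof -
    have "tor i ?z = (\<Sum>k\<in>{1..r}. if k = i then g i * (1 mod int (n i)) else 0)"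
      unfolding coordinate_simps tor_basic_cycle tor_tors by (intro sum.cong) auto
    then have "tor i ?z = g i * (1 mod int (n i))"
      using that by simp
    moreover have "1 mod int (n i) mod int modulus = 1 mod int modulus"
      using modulus_dvd_n[OF that] by (intro mod_mod_cancel) simp
    ultimately show ?thesis
      by (metis mod_mult_right_eq mult.right_neutral)
  qed
qed

text \<open>The pairs of orbit indices are listed row by row,
  \<open>m = (i - 1) * r + (j - 1)\<close>, to obtain a product over an initial segment of the
  naturals; the shifts by one arise because orbits are numbered from 1.\<close>

definition coordinates :: "((nat \<times> int) list \<Rightarrow>\<^sub>0 int) \<Rightarrow> (nat \<Rightarrow> int) \<times> (nat \<Rightarrow> int)"
  where "coordinates z =
    (\<lambda>m\<in>{..<r\<^sup>2}. coord (m div r + 1) (m mod r + 1) z,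
     \<lambda>i\<in>{..<r}. tor (i + 1) z mod int modulus)"

lemma modulus_pos: "modulus > 0"
  using modulus_cases by auto

text \<open>First isomorphism theorem for \<open>coordinates\<close> on the cycles:
  \<open>cycle_in_bds_iff\<close> identifies the kernel and \<open>cycle_with_coordinates\<close>
  gives surjectivity.\<close>

lemma rack_homology_2:
  "rack_homology 2 X (U_tri n) \<cong>
    product_group {..<r\<^sup>2} (\<lambda>_. integer_group) \<times>\<times>
    product_group {..<r} (\<lambda>_. integer_mod_group modulus)"
    (is "_ \<cong> ?H")
proof -
  let ?C = "rack_chains X 2"
  let ?G = "subgroup_generated ?C cycles"
  have index: "m div r + 1 \<in> {1..r}" "m mod r + 1 \<in> {1..r}" if "m < r\<^sup>2" for m
    using that r_ge_3 by (auto simp: power2_eq_square less_mult_imp_div_less Suc_le_eq)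
  have kernel: "kernel ?C (rack_chains X (2 - 1)) (rack_boundary (U_tri n)) = cycles"
    by (auto simp: kernel_def cycles_def rack_chains_def)
  have sub: "subgroup cycles ?C"
    unfolding rack_chains_def by (rule cycles.subgroup_free_Abelian_group) (simp add: cycles_def)
  have carrier: "carrier ?G = cycles"
    by (rule subgroup.carrier_subgroup_generated_subgroup[OF sub])
  have mult: "u \<otimes>\<^bsub>?G\<^esub> v = u + v" for u v
    by (simp add: rack_chains_def)
  have group_G: "group ?G"
    by (intro group.group_subgroup_generated) (simp add: rack_chains_def)
  have group_H: "group ?H"
    by (intro DirProd_group product_group) simp_all
  have "coordinates \<in> hom ?G ?H"
  proof (rule homI)
    show "coordinates u \<in> carrier ?H" for u
      using modulus_pos by (auto simp: coordinates_def carrier_integer_mod_group)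
    show "coordinates (u \<otimes>\<^bsub>?G\<^esub> v) = coordinates u \<otimes>\<^bsub>?H\<^esub> coordinates v" for u v
      unfolding mult
      by (auto simp: coordinates_def coord_simps coordinate_simps mod_add_eq fun_eq_iff)
  qed
  then interpret group_hom ?G ?H coordinates
    using group_G group_H by (intro group_hom.intro group_hom_axioms.intro)
  have kernel_bds: "kernel ?G ?H coordinates = bds"
  proof -
    have one_iff: "coordinates z = \<one>\<^bsub>?H\<^esub> \<longleftrightarrow>
        (\<forall>i\<in>{1..r}. (\<forall>j\<in>{1..r}. coord i j z = 0) \<and> int modulus dvd tor i z)" for z
    proof
      assume one: "coordinates z = \<one>\<^bsub>?H\<^esub>"
      show "\<forall>i\<in>{1..r}. (\<forall>j\<in>{1..r}. coord i j z = 0) \<and> int modulus dvd tor i z"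
      proof (intro ballI conjI)
        fix i assume i: "i \<in> {1..r}"
        have "(\<lambda>i\<in>{..<r}. tor (i + 1) z mod int modulus) = (\<lambda>i\<in>{..<r}. 0)"
          using one by (simp add: coordinates_def)
        from fun_cong[OF this, of "i - 1"] have "tor (i - 1 + 1) z mod int modulus = 0"
          using i diff_less[of 1 i] by (simp add: less_le_trans[of "i - Suc 0" i r])
        then show "int modulus dvd tor i z"
          using i by auto
        fix j assume j: "j \<in> {1..r}"
        have m: "(i - 1) * r + (j - 1) < r\<^sup>2"
        proof -
          have "(i - 1) * r + (j - 1) < (i - 1) * r + r"
            using j by auto
          also have "\<dots> = i * r"
            using i by (simp add: algebra_simps)
          also have "\<dots> \<le> r\<^sup>2"
            using i by (simp add: power2_eq_square)
          finally show ?thesis .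
        qed
        have "(\<lambda>m\<in>{..<r\<^sup>2}. coord (m div r + 1) (m mod r + 1) z) = (\<lambda>m\<in>{..<r\<^sup>2}. 0)"
          using one by (simp add: coordinates_def)
        from fun_cong[OF this, of "(i - 1) * r + (j - 1)"] m
        have "coord (((i - 1) * r + (j - 1)) div r + 1) (((i - 1) * r + (j - 1)) mod r + 1) z = 0"
          by simp
        moreover have "((i - 1) * r + (j - 1)) div r = i - 1" "((i - 1) * r + (j - 1)) mod r = j - 1"
          using r_ge_3 j by (simp_all only: div_mult_self3 mod_mult_self3) auto
        ultimately have "coord (i - 1 + 1) (j - 1 + 1) z = 0"
          by simp
        then show "coord i j z = 0"
          using i j by simp
      qed
    next
      assume *: "\<forall>i\<in>{1..r}. (\<forall>j\<in>{1..r}. coord i j z = 0) \<and> int modulus dvd tor i z"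
      have "coord (m div r + 1) (m mod r + 1) z = 0" if "m < r\<^sup>2" for m
        using * index[OF that] by blast
      moreover have "tor (k + 1) z mod int modulus = 0" if "k < r" for k
        using * that by (intro dvd_imp_mod_0) simp
      ultimately show "coordinates z = \<one>\<^bsub>?H\<^esub>"
        by (simp add: coordinates_def cong: restrict_cong)
    qed
    have "z \<in> kernel ?G ?H coordinates \<longleftrightarrow> z \<in> bds" for z
    proof -
      have "z \<in> kernel ?G ?H coordinates \<longleftrightarrow> z \<in> cycles \<and> coordinates z = \<one>\<^bsub>?H\<^esub>"
        by (simp only: kernel_def mem_Collect_eq carrier)
      also have "\<dots> \<longleftrightarrow> z \<in> cycles \<and> z \<in> bds"
        by (simp only: one_iff cycle_in_bds_iff cong: conj_cong)
      finally show ?thesis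
        using bds_subset_cycles by blast
    qed
    then show ?thesis
      by blast
  qed
  have image: "coordinates ` carrier ?G = carrier ?H"
  proof
    show "coordinates ` carrier ?G \<subseteq> carrier ?H"
      using hom_closed by blast
    show "carrier ?H \<subseteq> coordinates ` carrier ?G"
    proof
      fix h assume "h \<in> carrier ?H"
      then obtain f g where h: "h = (f, g)" and f: "f \<in> extensional {..<r\<^sup>2}"
        and g: "g \<in> {..<r} \<rightarrow>\<^sub>E carrier (integer_mod_group modulus)"
        by (auto simp: PiE_def)
      obtain z where z: "z \<in> cycles"
        "\<And>i j. \<lbrakk>i \<in> {1..r}; j \<in> {1..r}\<rbrakk> \<Longrightarrow> coord i j z = f ((i - 1) * r + (j - 1))"
        "\<And>i. i \<in> {1..r} \<Longrightarrow> tor i z mod int modulus = g (i - 1) mod int modulus"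
        by (rule cycle_with_coordinates[where f = "\<lambda>i j. f ((i - 1) * r + (j - 1))"
              and g = "\<lambda>i. g (i - 1)"]) (rule that)
      have "(\<lambda>m\<in>{..<r\<^sup>2}. coord (m div r + 1) (m mod r + 1) z) = f"
      proof (rule extensionalityI[OF restrict_extensional f])
        fix m assume m: "m \<in> {..<r\<^sup>2}"
        have "coord (m div r + 1) (m mod r + 1) z = f ((m div r + 1 - 1) * r + (m mod r + 1 - 1))"
          using m by (intro z(2) index) simp_all
        then show "(\<lambda>m\<in>{..<r\<^sup>2}. coord (m div r + 1) (m mod r + 1) z) m = f m"
          using m by simp
      qed
      moreover have "(\<lambda>i\<in>{..<r}. tor (i + 1) z mod int modulus) = g"
      proof (rule extensionalityI[OF restrict_extensional])
        show "g \<in> extensional {..<r}"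
          using g by (simp add: PiE_def)
        fix k assume k: "k \<in> {..<r}"
        have "tor (k + 1) z mod int modulus = g (k + 1 - 1) mod int modulus"
          using k by (intro z(3)) simp
        moreover have "g k \<in> {0..<int modulus}"
          using PiE_mem[OF g k] modulus_pos by (simp add: carrier_integer_mod_group)
        ultimately show "(\<lambda>i\<in>{..<r}. tor (i + 1) z mod int modulus) k = g k"
          using k by simp
      qed
      ultimately have "coordinates z = h"
        by (simp only: h coordinates_def)
      then show "h \<in> coordinates ` carrier ?G"
        unfolding carrier using z(1) by (rule image_eqI[OF HOL.sym])
    qed
  qed
  have "Suc 2 = (3 :: nat)"
    by simp
  then show ?thesis
    using FactGroup_iso[OF image] unfolding rack_homology_def kernel kernel_bds by (simp only:)
qed

lemma rack_homology_2_free: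
  assumes "r \<ge> 4"
  shows "rack_homology 2 X (U_tri n) \<cong> product_group {..<r\<^sup>2} (\<lambda>_. integer_group)"
proof (rule iso_trans[OF rack_homology_2 DirProd_trivial_iso])
  have "modulus = 1"
    using assms by (simp add: modulus_def)
  moreover have "{0..<1::int} = {0}"
    by auto
  moreover have "({..<r} \<rightarrow>\<^sub>E {0}) = {\<lambda>i\<in>{..<r}. 0 :: int}"
    by (auto simp: PiE_iff fun_eq_iff extensional_def)
  ultimately show "carrier (product_group {..<r} (\<lambda>_. integer_mod_group modulus)) =
      {\<one>\<^bsub>product_group {..<r} (\<lambda>_. integer_mod_group modulus)\<^esub>}"
    by (simp add: carrier_integer_mod_group)
qed

end

section \<open>Exponent sums of words and the torsion groups\<close>

definition letter_count :: "('b \<Rightarrow> bool) \<Rightarrow> 'b word \<Rightarrow> int"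
  where "letter_count P u = (\<Sum>(b, e)\<leftarrow>u. if P b then if e then 1 else -1 else 0)"

lemma letter_count_simps:
  "letter_count P [] = 0"
  "letter_count P ((b, e) # u) = (if P b then if e then 1 else -1 else 0) + letter_count P u"
  "letter_count P (u @ v) = letter_count P u + letter_count P v"
  by (simp_all add: letter_count_def)

context U_orbit_setup
begin

lemma path_end_el:
  "set u \<subseteq> X \<times> UNIV \<Longrightarrow>
    path_end (el i x) u = el i (x + letter_count (\<lambda>b. fst b \<noteq> i) u)"
proof (induction u arbitrary: x)
  case Nil
  then show ?case by (simp add: letter_count_simps)
next
  case (Cons p u)
  obtain b e where p: "p = (b, e)" by fastforce
  then have "b \<in> X" and u: "set u \<subseteq> X \<times> UNIV"
    using Cons.prems by auto
  then obtain j y where b: "b = el j y" and j: "j \<in> {1..r}"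
    by (elim X_E)
  show ?case
    using Cons.IH[OF u]
    by (cases e) (simp_all add: p b U_tri_elem inverse_tri_el[OF i j] letter_count_simps
        of_bool_def algebra_simps)
qed

lemma cnt_path_chain:
  "set u \<subseteq> X \<times> UNIV \<Longrightarrow>
    cnt i j (path_chain X (U_tri n) (el i x) u) = letter_count (\<lambda>b. fst b = j) u"
proof (induction u arbitrary: x)
  case Nil
  then show ?case by (simp add: letter_count_simps coordinate_simps)
next
  case (Cons p u)
  obtain b e where p: "p = (b, e)" by fastforce
  then have "b \<in> X" and u: "set u \<subseteq> X \<times> UNIV"
    using Cons.prems by auto
  then obtain k y where b: "b = el k y" and k: "k \<in> {1..r}"
    by (elim X_E)
  have single: "cnt i j (frag_of [el i x, el k y]) = of_bool (k = j)" for x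
    using cnt_pair[of i j i x k y] by (simp add: pair_def)
  show ?case
    using Cons.IH[OF u]
    by (cases e) (simp_all add: p b U_tri_elem inverse_tri_el[OF i k] letter_count_simps
        coordinate_simps single)
qed

text \<open>When \<open>P\<close> only depends on the orbit, both sides of a structure relation have
  the same exponent sum, so the sum is a homomorphism on the structure group and vanishes on
  commutators.\<close>

lemma letter_count_derived:
  assumes "\<And>a b. \<lbrakk>a \<in> X; b \<in> X\<rbrakk> \<Longrightarrow> P (U_tri n a b) = P a"
    and "pres_class X structure_relators u \<in> derived (structure_group X (U_tri n))
      (carrier (structure_group X (U_tri n)))"
    and "set u \<subseteq> X \<times> UNIV"
  shows "letter_count P u = 0"
  using assms(2,3) unfolding structure_group_eq
  by (rule additive_on_derived[rotated 3])
    (auto simp: letter_count_simps structure_relators_def assms(1) simp del: U_tri.simps)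

lemma fst_U_tri: "fst (U_tri n a b) = fst a"
  by (cases a; cases b) simp

abbreviation tors_coset :: "int \<Rightarrow> ((nat \<times> int) list \<Rightarrow>\<^sub>0 int) set"
  where "tors_coset m \<equiv> bd i #>\<^bsub>orbit_chains X (U_orbit n i) 2\<^esub> frag_cmul m (tors i)"

text \<open>\<open>tors i\<close> has order exactly \<open>modulus\<close>:
  \<open>modulus_tors\<close> bounds the order from above, and the invariant \<open>tor\<close>
  bounds it from below.\<close>

lemma tors_coset_eq_iff: "tors_coset m = tors_coset m' \<longleftrightarrow> m mod int modulus = m' mod int modulus"
proof -
  have "frag_cmul m (tors i) - frag_cmul m' (tors i) \<in> bd i \<longleftrightarrow> int modulus dvd m - m'"
  proof
    assume "frag_cmul m (tors i) - frag_cmul m' (tors i) \<in> bd i"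
    then have "int modulus dvd (m - m') * (1 mod int (n i))"
      using modulus_dvd_tor[OF subsetD[OF bd_subset_bds] i]
      by (fastforce simp: coordinate_simps tor_tors algebra_simps)
    moreover have "(m - m') * (1 mod int (n i)) mod int modulus = (m - m') mod int modulus"
    proof -
      have "1 mod int (n i) mod int modulus = 1 mod int modulus"
        using modulus_dvd_n[OF i] by (intro mod_mod_cancel) simp
      then show ?thesis
        by (metis mod_mult_right_eq mult.right_neutral)
    qed
    ultimately show "int modulus dvd m - m'"
      by (metis dvd_eq_mod_eq_0)
  next
    assume "int modulus dvd m - m'"
    then obtain q where "m - m' = q * int modulus"
      by (metis dvdE mult.commute)
    then have "frag_cmul m (tors i) - frag_cmul m' (tors i) =
        frag_cmul q (frag_cmul (int modulus) (tors i))"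
      by (metis frag_cmul_cmul frag_cmul_diff_distrib)
    then show "frag_cmul m (tors i) - frag_cmul m' (tors i) \<in> bd i"
      using orb.boundaries.cmul_mem[OF modulus_tors] by simp
  qed
  then show ?thesis
    by (simp add: orbit_chains_def orb.boundaries.r_coset_eq_iff mod_eq_dvd_iff)
qed

lemma path_map_derived:
  assumes g: "g \<in> derived (structure_group X (U_tri n)) (carrier (structure_group X (U_tri n)))"
  obtains m where "path_map X (U_tri n) (U_orbit n i) (el i x) g = tors_coset m"
proof -
  have "g \<in> carrier (structure_group X (U_tri n))"
    using group.derived_in_carrier[OF group_presented_group order.refl] g
    unfolding structure_group_eq by blast
  then obtain u where u: "g = pres_class X structure_relators u" "set u \<subseteq> X \<times> UNIV"
    unfolding structure_group_eq by (rule carrier_presented_groupE)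
  let ?c = "path_chain X (U_tri n) (el i x) u"
  have el: "el i x \<in> U_orbit n i"
    using i by (simp add: el_in_orbit_iff)
  have keys: "Poly_Mapping.keys ?c \<subseteq> {xs \<in> tuples X 2. hd xs \<in> U_orbit n i}"
    by (rule orb.path_chain_keys[OF el u(2)])
  have count: "letter_count P u = 0" if "\<And>a b. P (U_tri n a b) = P a" for P
    using letter_count_derived[of P u] that g u by simp
  have "cnt i j ?c = 0" for j
    unfolding cnt_path_chain[OF u(2)] by (rule count) (simp add: fst_U_tri)
  moreover have cycle: "rack_boundary (U_tri n) ?c = 0"
    using boundary_path_chain[OF el_in_X[OF i] u(2)] path_end_el[OF u(2)]
      count[of "\<lambda>b. fst b \<noteq> i"] by (simp add: fst_U_tri)
  moreover have "wgt i y ?c = 0" for y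
  proof -
    have keys2: "Poly_Mapping.keys ?c \<subseteq> tuples X 2"
      using keys by blast
    \<comment> \<open>The weights of a cycle agree at all points and add up to the counts outside
      column \<open>i\<close>, which are 0; as \<open>n i > 0\<close>, the common weight is
      0.\<close>
    have "(\<Sum>y\<in>{0..<int (n i)}. wgt i 0 ?c) = (\<Sum>y\<in>{0..<int (n i)}. wgt i y ?c)"
      by (intro sum.cong HOL.refl wgt_cycle[OF keys2 cycle, symmetric])
    also have "\<dots> = 0"
      unfolding wgt_total[OF keys2] using \<open>\<And>j. cnt i j ?c = 0\<close> by (intro sum.neutral) simp
    finally have "wgt i 0 ?c = 0"
      using n_pos[OF i] by simp
    then show ?thesis
      unfolding wgt_cycle[OF keys2 cycle, of i y] .
  qed
  ultimately have "normal_form i ?c = frag_cmul (tor i ?c) (tors i)"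
    by (intro normal_form_eq_tors i)
  then have "?c - frag_cmul (tor i ?c) (tors i) \<in> bd i"
    using normal_form_orbit[OF i keys] by simp
  then have "path_map X (U_tri n) (U_orbit n i) (el i x) g = tors_coset (tor i ?c)"
    unfolding u(1) orb.path_map_pres_class[OF el u(2)]
    by (simp add: orbit_chains_def orb.boundaries.r_coset_eq_iff)
  then show ?thesis
    by (rule that)
qed

text \<open>The witness is the commutator of a generator from orbit \<open>i\<close>, which fixes
  the point, with one from the pivot orbit, which shifts it. Along this path the two pivot pairs
  cancel, and the own column is read once before and once after the shift.\<close>

lemma tors_coset_in_path_map:
  "tors_coset (-1) \<in> path_map X (U_tri n) (U_orbit n i) (el i x) `
    derived (structure_group X (U_tri n)) (carrier (structure_group X (U_tri n)))"
proof -
  let ?G = "structure_group X (U_tri n)" and ?cls = "pres_class X structure_relators"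
  let ?b = "el i 0" and ?c = "el (pivot i) 0"
  let ?w = "[(?b, True), (?c, True), (?b, False), (?c, False)]"
  have mem: "?b \<in> X" "?c \<in> X"
    using el_in_X i pivot(1) by blast+
  have el: "el i x \<in> U_orbit n i"
    using i by (simp add: el_in_orbit_iff)
  have "?cls [(?b, True)] \<otimes>\<^bsub>?G\<^esub> ?cls [(?c, True)] \<otimes>\<^bsub>?G\<^esub>
      inv\<^bsub>?G\<^esub> (?cls [(?b, True)]) \<otimes>\<^bsub>?G\<^esub> inv\<^bsub>?G\<^esub> (?cls [(?c, True)]) = ?cls ?w"
    unfolding structure_group_eq using mem by (simp add: inv_pres_class mult_pres_class)
  moreover have "?cls [(?b, True)] \<in> carrier ?G" "?cls [(?c, True)] \<in> carrier ?G"
    unfolding structure_group_eq using mem by (simp_all add: pres_class_carrier)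
  ultimately have derived: "?cls ?w \<in> derived ?G (carrier ?G)"
    unfolding derived_def by (intro generate.incl) blast
  have chain: "path_chain X (U_tri n) (el i x) ?w = pair i x i 0 - pair i (x + 1) i 0"
    using pivot(2)[of i, symmetric] i pivot(1)[of i]
    by (simp add: U_tri_elem inverse_tri_el pair_def)
  have w: "set ?w \<subseteq> X \<times> UNIV"
    using mem by simp
  have "path_map X (U_tri n) (U_orbit n i) (el i x) (?cls ?w) =
      bd i #>\<^bsub>orbit_chains X (U_orbit n i) 2\<^esub> (pair i x i 0 - pair i (x + 1) i 0)"
    unfolding orb.path_map_pres_class[OF el w] chain ..
  also have "\<dots> = tors_coset (-1)"
    unfolding orbit_chains_def orb.boundaries.r_coset_eq_iff
    using orb.boundaries.uminus_mem[OF own_first[of x 0]] by (simp add: algebra_simps)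
  finally show ?thesis
    using derived by (intro image_eqI[OF HOL.sym])
qed

text \<open>As \<open>modulus\<close> is 1 or 2, at most two cosets have to be reached: the identity
  gives the trivial one, and a single commutator gives the other because -1 and 1 agree modulo
  2.\<close>

lemma path_map_derived_image:
  "path_map X (U_tri n) (U_orbit n i) (el i x) `
    derived (structure_group X (U_tri n)) (carrier (structure_group X (U_tri n))) =
    tors_coset ` carrier (integer_mod_group modulus)" (is "?K = ?T")
proof
  have coset_mod: "tors_coset m \<in> ?T" for m
  proof (rule image_eqI)
    show "tors_coset m = tors_coset (m mod int modulus)"
      by (simp add: tors_coset_eq_iff)
    show "m mod int modulus \<in> carrier (integer_mod_group modulus)"
      using modulus_pos by (simp add: carrier_integer_mod_group)
  qed
  show "?K \<subseteq> ?T"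
  proof
    fix K assume "K \<in> ?K"
    then obtain g where g: "K = path_map X (U_tri n) (U_orbit n i) (el i x) g"
      "g \<in> derived (structure_group X (U_tri n)) (carrier (structure_group X (U_tri n)))"
      by blast
    obtain m where "path_map X (U_tri n) (U_orbit n i) (el i x) g = tors_coset m"
      using g(2) by (rule path_map_derived)
    then show "K \<in> ?T"
      using coset_mod g(1) by simp
  qed
  show "?T \<subseteq> ?K"
  proof
    fix K assume "K \<in> ?T"
    then obtain m where m: "K = tors_coset m" "m \<in> {0..<int modulus}"
      using modulus_pos by (auto simp: carrier_integer_mod_group)
    then consider "m = 0" | "m = 1" "modulus = 2"
      using modulus_cases by fastforce
    then show "K \<in> ?K"
    proof cases
      case 1
      have el: "el i x \<in> U_orbit n i"
        using i by (simp add: el_in_orbit_iff)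
      have "path_map X (U_tri n) (U_orbit n i) (el i x) (pres_class X structure_relators []) = K"
        using orb.path_map_pres_class[OF el, of "[]"] by (simp add: m 1)
      moreover have "pres_class X structure_relators [] \<in>
          derived (structure_group X (U_tri n)) (carrier (structure_group X (U_tri n)))"
        unfolding derived_def structure_group_eq one_presented_group[symmetric]
        by (rule generate.one)
      ultimately show ?thesis
        by (intro image_eqI[OF HOL.sym])
    next
      case 2
      then have "K = tors_coset (-1)"
        unfolding m(1) tors_coset_eq_iff by simp
      then show ?thesis
        using tors_coset_in_path_map by simp
    qed
  qed
qed

lemma torsion_group_el:
  "integer_mod_group modulus \<cong> torsion_group X (U_tri n) (U_orbit n i) (el i x)"
proof -
  let ?T = "torsion_group X (U_tri n) (U_orbit n i) (el i x)"
  have carrier: "carrier ?T = tors_coset ` carrier (integer_mod_group modulus)"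
    by (simp add: torsion_group_def path_map_derived_image)
  have mult: "tors_coset m \<otimes>\<^bsub>?T\<^esub> tors_coset m' = tors_coset (m + m')" for m m'
    by (simp add: torsion_group_def orbit_quotient_2_def orbit_chains_def
        orb.boundaries.set_mult_r_coset frag_cmul_distrib)
  have "tors_coset \<in> iso (integer_mod_group modulus) ?T"
  proof (intro isoI homI bij_betw_imageI inj_onI)
    show "tors_coset m \<in> carrier ?T" if "m \<in> carrier (integer_mod_group modulus)" for m
      unfolding carrier using that by (rule imageI)
    show "tors_coset (m \<otimes>\<^bsub>integer_mod_group modulus\<^esub> m') = tors_coset m \<otimes>\<^bsub>?T\<^esub> tors_coset m'"
      for m m'
      unfolding mult by (simp add: tors_coset_eq_iff)
    show "m = m'"
      if "m \<in> carrier (integer_mod_group modulus)" "m' \<in> carrier (integer_mod_group modulus)"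
        "tors_coset m = tors_coset m'" for m m'
      using that modulus_pos by (auto simp: carrier_integer_mod_group tors_coset_eq_iff)
    show "tors_coset ` carrier (integer_mod_group modulus) = carrier ?T"
      by (rule carrier[symmetric])
  qed
  then show ?thesis
    by (rule is_isoI)
qed

end

section \<open>The orbits and the parameters of U\<close>

lemma frag_subgroup_of_subgroup:
  assumes "subgroup N (free_Abelian_group S)"
  shows "frag_subgroup N"
proof
  show "0 \<in> N"
    using subgroup.one_closed[OF assms] by simp
  show "u - v \<in> N" if "u \<in> N" "v \<in> N" for u v
    using subgroup.m_closed[OF assms that(1) subgroup.m_inv_closed[OF assms that(2)]]
      subgroup.subset[OF assms] that by auto
qed

lemma relator_carrier:
  fixes k r :: nat
  shows "k < r \<Longrightarrow> (\<Sum>j = 1..k. frag_cmul (m j) (frag_of j)) \<in> carrier (free_Abelian_group {1..<r})"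
  by (intro sum_closed_free_Abelian_group) auto

lemma subgroup_collection_relations:
  "subgroup (collection_relations r m) (free_Abelian_group {1..<r})"
  unfolding collection_relations_def
  by (intro group.generate_is_subgroup group_free_Abelian_group)
    (rule subsetI, clarify, rule relator_carrier, simp)

lemma comm_group_collection_group: "comm_group (collection_group r m)"
  unfolding collection_group_def
  by (intro comm_group.abelian_FactGroup abelian_free_Abelian_group subgroup_collection_relations)

lemma collection_gen_carrier:
  assumes "k < r"
  shows "collection_gen r m k \<in> carrier (collection_group r m)"
proof (cases "k = 0")
  case True
  then show ?thesis
    using comm_group_collection_group[of r m]
    by (simp add: collection_gen_def comm_group_def group.is_monoid monoid.one_closed)
next
  case False
  then have "frag_of k \<in> carrier (free_Abelian_group {1..<r})"
    using assms by simp
  with False show ?thesis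
    unfolding collection_gen_def collection_group_def carrier_FactGroup by simp
qed

context U_setup
begin

lemma translation_group_elem:
  assumes "g \<in> carrier (translation_group X (U_tri n))"
  shows "g \<in> Bij X \<and> (\<forall>p\<in>X. fst (g p) = fst p)"
proof -
  have fst_tri: "fst (U_tri n a b) = fst a" for a b
    by (cases a; cases b) simp
  have "g \<in> generate (BijGroup X) (carrier (BijGroup X) \<inter> {\<lambda>a\<in>X. U_tri n a b |b. b \<in> X})"
    using assms by (simp add: translation_group_def carrier_subgroup_generated)
  then show ?thesis
  proof (induction rule: generate.induct)
    case one
    then show ?case
      using id_Bij[of X] by (simp add: BijGroup_def restrict_def)
  next
    case (incl h)
    then show ?case by (auto simp: BijGroup_def fst_tri)
  next
    case (inv h)
    then have fst_h: "fst (h p) = fst p" if "p \<in> X" for p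
      using that by (auto simp: BijGroup_def fst_tri)
    have "h \<in> Bij X"
      using inv by (simp add: BijGroup_def)
    have "fst (inv_into X h p) = fst p" if "p \<in> X" for p
    proof -
      have "h ` X = X"
        using \<open>h \<in> Bij X\<close> by (simp add: Bij_def bij_betw_def)
      then have "h (inv_into X h p) = p" "inv_into X h p \<in> X"
        using that f_inv_into_f[of p h X] inv_into_into[of p h X] by simp_all
      then show ?thesis
        using fst_h[of "inv_into X h p"] by simp
    qed
    then show ?case
      using \<open>h \<in> Bij X\<close> restrict_inv_into_Bij[of h X] by (simp add: inv_BijGroup restrict_def)
  next
    case (eng g h)
    moreover from this have "h p \<in> X" if "p \<in> X" for p
      using that Bij_imp_funcset[of h X] by blast
    ultimately show ?case
      by (simp add: BijGroup_def compose_Bij) (simp add: compose_def)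
  qed
qed

text \<open>Powers of the translation by one point of the pivot orbit already act transitively on
  orbit \<open>i\<close>.\<close>

lemma translation_group_shift:
  assumes "i \<in> {1..r}"
  shows "\<exists>g\<in>carrier (translation_group X (U_tri n)). g (el i x) = el i (x + int k)"
proof -
  let ?gens = "{\<lambda>a\<in>X. U_tri n a b |b. b \<in> X}"
  let ?h = "\<lambda>a\<in>X. U_tri n a (el (pivot i) 0)"
  have carrier: "carrier (translation_group X (U_tri n)) =
      generate (BijGroup X) (carrier (BijGroup X) \<inter> ?gens)"
    by (simp add: translation_group_def carrier_subgroup_generated)
  have b: "el (pivot i) 0 \<in> X"
    using pivot(1) by (rule el_in_X)
  have "?h \<in> Bij X"
    using bij_betw_cong[of X ?h "\<lambda>a. U_tri n a (el (pivot i) 0)" X] bij_U_tri[OF b]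
    by (simp add: Bij_def)
  moreover have "?h \<in> ?gens"
    using b by blast
  ultimately have h: "?h \<in> carrier (BijGroup X) \<inter> ?gens" "?h \<in> Bij X"
    by (simp_all add: BijGroup_def)
  show ?thesis
    unfolding carrier
  proof (induction k)
    case 0
    have "\<one>\<^bsub>BijGroup X\<^esub> (el i x) = el i (x + int 0)"
      using el_in_X[OF assms] by (simp add: BijGroup_def)
    then show ?case
      using generate.one by blast
  next
    case (Suc k)
    then obtain g where g: "g \<in> generate (BijGroup X) (carrier (BijGroup X) \<inter> ?gens)"
      "g (el i x) = el i (x + int k)"
      by blast
    have "g \<in> Bij X"
      using translation_group_elem g(1) unfolding carrier by blast
    then have "(?h \<otimes>\<^bsub>BijGroup X\<^esub> g) (el i x) = ?h (g (el i x))"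
      using h(2) el_in_X[OF assms] by (simp add: BijGroup_def compose_def)
    also have "\<dots> = el i (x + int (Suc k))"
      using el_in_X[OF assms] pivot(2)[of i] by (simp add: g(2) U_tri_elem algebra_simps)
    finally show ?case
      using generate.eng[OF generate.incl[OF h(1)] g(1)] by blast
  qed
qed

lemma orbit_el:
  assumes i: "i \<in> {1..r}"
  shows "orbit (translation_group X (U_tri n)) (\<lambda>g. g) (el i x) = U_orbit n i"
proof (intro subset_antisym subsetI)
  fix p assume "p \<in> orbit (translation_group X (U_tri n)) (\<lambda>g. g) (el i x)"
  then obtain g where g: "g \<in> carrier (translation_group X (U_tri n))" "p = g (el i x)"
    by (auto simp: orbit_def)
  have "p \<in> X" "fst p = i"
    using translation_group_elem[OF g(1)] el_in_X[OF i, of x] Bij_imp_funcset[of g X]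
    by (auto simp: g(2))
  then show "p \<in> U_orbit n i"
    by (auto simp: U_quandle_def U_orbit_def)
next
  fix p assume "p \<in> U_orbit n i"
  then obtain y where p: "p = el i y"
    using i by (elim U_orbitE)
  \<comment> \<open>Only shifts by natural numbers are available, so \<open>y - x\<close> is
    replaced by its nonnegative residue.\<close>
  obtain g where g: "g \<in> carrier (translation_group X (U_tri n))"
    "g (el i x) = el i (x + int (nat ((y - x) mod int (n i))))"
    using translation_group_shift[OF i] by blast
  have "el i (x + int (nat ((y - x) mod int (n i)))) = p"
    using n_pos[OF i] by (simp add: p U_elem_eq_iff mod_simps)
  then have "p = g (el i x)"
    by (simp only: g(2))
  then show "p \<in> orbit (translation_group X (U_tri n)) (\<lambda>g. g) (el i x)"
    using g(1) unfolding orbit_def by blast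
qed

lemma bij_betw_U_orbit: "bij_betw (U_orbit n) {1..r} (quandle_orbits X (U_tri n))"
proof (rule bij_betw_imageI)
  show "inj_on (U_orbit n) {1..r}"
  proof (rule inj_onI)
    fix i j assume "i \<in> {1..r}" "j \<in> {1..r}" "U_orbit n i = U_orbit n j"
    then show "i = j"
      using el_in_orbit_iff[of i 0 i] el_in_orbit_iff[of i 0 j] by simp
  qed
  show "U_orbit n ` {1..r} = quandle_orbits X (U_tri n)"
  proof (intro subset_antisym subsetI)
    fix Y assume "Y \<in> U_orbit n ` {1..r}"
    then obtain i where i: "i \<in> {1..r}" "Y = U_orbit n i"
      by blast
    then show "Y \<in> quandle_orbits X (U_tri n)"
      using orbit_el[OF i(1), of 0] el_in_X[OF i(1), of 0]
      unfolding quandle_orbits_def orbits_def by blast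
  next
    fix Y assume "Y \<in> quandle_orbits X (U_tri n)"
    then obtain p where p: "p \<in> X" "Y = orbit (translation_group X (U_tri n)) (\<lambda>g. g) p"
      unfolding quandle_orbits_def orbits_def by blast
    from p(1) obtain i x where "p = el i x" "i \<in> {1..r}"
      by (rule X_E)
    then show "Y \<in> U_orbit n ` {1..r}"
      using p(2) orbit_el by blast
  qed
qed

text \<open>These encode that the first generator has order dividing \<open>n i\<close> and that
  every other generator equals it. The latter is written with exponent \<open>n i - 1\<close>
  instead of -1, because entries below the diagonal must be nonnegative and smaller than the
  diagonal entry of their column. The remaining diagonal entries are 1 and force zeros below
  them.\<close>

definition U_parameters :: "nat \<Rightarrow> nat \<Rightarrow> nat \<Rightarrow> int"
  where "U_parameters i k j =
    (if j = 1 then if k = 1 then int (n i) else int (n i) - 1 else of_bool (j = k))"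

lemma parameter_collection_U:
  "i \<in> {1..r} \<Longrightarrow> parameter_collection r (U_parameters i)"
  using n_pos[of i] by (auto simp: parameter_collection_def U_parameters_def)

abbreviation U_relations :: "nat \<Rightarrow> (nat \<Rightarrow>\<^sub>0 int) set"
  where "U_relations i \<equiv> collection_relations r (U_parameters i)"

lemma U_relator:
  assumes "k \<ge> 1"
  shows "(\<Sum>j=1..k. frag_cmul (U_parameters i k j) (frag_of j)) =
    (if k = 1 then frag_cmul (int (n i)) (frag_of 1)
     else frag_cmul (int (n i) - 1) (frag_of 1) + frag_of k)"
proof (cases "k = 1")
  case True
  then show ?thesis by (simp add: U_parameters_def)
next
  case False
  then have "(\<Sum>j=1..k. frag_cmul (U_parameters i k j) (frag_of j)) =
      (\<Sum>j\<in>{1, k}. frag_cmul (U_parameters i k j) (frag_of j))"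
    using assms by (intro sum.mono_neutral_right) (auto simp: U_parameters_def)
  then show ?thesis
    using False by (simp add: U_parameters_def)
qed

text \<open>Each relator has coefficient sum \<open>n i\<close>; conversely, the relators reduce
  every element to a multiple of the first generator. So the group is cyclic of order
  \<open>n i\<close>, with the coefficient sum as its coordinate.\<close>

lemma U_relations_iff:
  assumes i: "i \<in> {1..r}" and c: "Poly_Mapping.keys c \<subseteq> {1..<r}"
  shows "c \<in> U_relations i \<longleftrightarrow> int (n i) dvd frag_eval (\<lambda>_. 1) c"
proof
  let ?D = "{c. Poly_Mapping.keys c \<subseteq> {1..<r} \<and> int (n i) dvd frag_eval (\<lambda>_. 1) c}"
  have "frag_subgroup ?D"
  proof
    show "u - v \<in> ?D" if "u \<in> ?D" "v \<in> ?D" for u v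
      using that keys_diff[of u v] by auto
  qed simp
  then have D: "subgroup ?D (free_Abelian_group {1..<r})"
    by (rule frag_subgroup.subgroup_free_Abelian_group) simp
  have "U_relations i \<subseteq> ?D"
    unfolding collection_relations_def
  proof (rule group.generate_subgroup_incl[OF group_free_Abelian_group _ D], rule subsetI)
    fix c assume "c \<in> {\<Sum>j = 1..k. frag_cmul (U_parameters i k j) (frag_of j) |k. k \<in> {1..<r}}"
    then obtain k where k: "c = (\<Sum>j=1..k. frag_cmul (U_parameters i k j) (frag_of j))"
      "k \<in> {1..<r}"
      by blast
    have "c \<in> carrier (free_Abelian_group {1..<r})"
      unfolding k(1) using k(2) by (intro relator_carrier) simp
    moreover have "frag_eval (\<lambda>_. 1) c = int (n i)"
      unfolding k(1) using k(2) by (subst U_relator) auto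
    ultimately show "c \<in> ?D"
      by simp
  qed
  then show "int (n i) dvd frag_eval (\<lambda>_. 1) c" if "c \<in> U_relations i"
    using that by blast
next
  assume dvd: "int (n i) dvd frag_eval (\<lambda>_. 1) c"
  interpret rels: frag_subgroup "U_relations i"
    using subgroup_collection_relations by (rule frag_subgroup_of_subgroup)
  have relator: "(\<Sum>j=1..k. frag_cmul (U_parameters i k j) (frag_of j)) \<in> U_relations i"
    if "k \<in> {1..<r}" for k
    unfolding collection_relations_def using that by (intro generate.incl) blast
  have n_gen: "frag_cmul (int (n i)) (frag_of 1) \<in> U_relations i"
    using relator[of 1] r_ge_3 by (simp add: U_parameters_def)
  have gens: "frag_of k - frag_of 1 \<in> U_relations i" if "k \<in> {1..<r}" for k
  proof (cases "k = 1")
    case False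
    then have "frag_cmul (int (n i) - 1) (frag_of 1) + frag_of k \<in> U_relations i"
      using relator[OF that] U_relator[of k i] that by simp
    from rels.diff_mem[OF this n_gen] show ?thesis
      by (simp add: frag_cmul_diff_distrib)
  qed (simp add: rels.zero_mem)
  have "c - frag_cmul (frag_eval (\<lambda>_. 1) c) (frag_of 1) \<in> U_relations i"
    using c
  proof (induction rule: frag_induction)
    case (diff u v)
    from rels.diff_mem[OF diff] show ?case
      by (simp add: frag_cmul_diff_distrib algebra_simps)
  next
    case (one k)
    then show ?case using gens by simp
  qed (simp add: rels.zero_mem)
  moreover obtain q where "frag_eval (\<lambda>_. 1) c = int (n i) * q"
    using dvd by (rule dvdE)
  then have "frag_cmul (frag_eval (\<lambda>_. 1) c) (frag_of 1) \<in> U_relations i"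
    using rels.cmul_mem[OF n_gen, of q] by (simp add: mult.commute)
  ultimately have "c - frag_cmul (frag_eval (\<lambda>_. 1) c) (frag_of 1) +
      frag_cmul (frag_eval (\<lambda>_. 1) c) (frag_of 1) \<in> U_relations i"
    by (rule rels.add_mem)
  then show "c \<in> U_relations i"
    by simp
qed

definition U_class :: "nat \<Rightarrow> int \<Rightarrow> (nat \<Rightarrow>\<^sub>0 int) set"
  where "U_class i x = U_relations i #>\<^bsub>free_Abelian_group {1..<r}\<^esub> frag_cmul x (frag_of 1)"

lemma coset_eq_U_class:
  assumes i: "i \<in> {1..r}" and c: "Poly_Mapping.keys c \<subseteq> {1..<r}"
  shows "U_relations i #>\<^bsub>free_Abelian_group {1..<r}\<^esub> c = U_class i x \<longleftrightarrow>
    frag_eval (\<lambda>_. 1) c mod int (n i) = x mod int (n i)"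
proof -
  interpret rels: frag_subgroup "U_relations i"
    using subgroup_collection_relations by (rule frag_subgroup_of_subgroup)
  have "Poly_Mapping.keys (c - frag_cmul x (frag_of 1)) \<subseteq> {1..<r}"
    using keys_diff[of c "frag_cmul x (frag_of 1)"] c r_ge_3 by (auto split: if_splits)
  then show ?thesis
    unfolding U_class_def rels.r_coset_eq_iff
    by (subst U_relations_iff[OF i]) (simp_all add: mod_eq_dvd_iff)
qed

lemma U_class_eq_iff:
  assumes "i \<in> {1..r}"
  shows "U_class i x = U_class i y \<longleftrightarrow> x mod int (n i) = y mod int (n i)"
proof -
  have "Poly_Mapping.keys (frag_cmul x (frag_of 1)) \<subseteq> {1..<r}"
    using r_ge_3 by (auto split: if_splits)
  from coset_eq_U_class[OF assms this, of y] show ?thesis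
    by (simp add: U_class_def)
qed

lemma carrier_U_group:
  assumes i: "i \<in> {1..r}"
  shows "carrier (collection_group r (U_parameters i)) = range (U_class i)"
proof (intro subset_antisym subsetI)
  fix K assume "K \<in> carrier (collection_group r (U_parameters i))"
  then obtain c where c: "K = U_relations i #>\<^bsub>free_Abelian_group {1..<r}\<^esub> c"
    "Poly_Mapping.keys c \<subseteq> {1..<r}"
    by (auto simp: collection_group_def carrier_FactGroup)
  then show "K \<in> range (U_class i)"
    using coset_eq_U_class[OF i c(2), of "frag_eval (\<lambda>_. 1) c"] by blast
next
  fix K assume "K \<in> range (U_class i)"
  moreover have "frag_cmul x (frag_of 1) \<in> carrier (free_Abelian_group {1..<r})" for x
    using r_ge_3 by (auto split: if_splits)
  ultimately show "K \<in> carrier (collection_group r (U_parameters i))"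
    unfolding collection_group_def carrier_FactGroup U_class_def by blast
qed

lemma U_class_mult_gen:
  assumes i: "i \<in> {1..r}" and k: "k < r"
  shows "U_class i x \<otimes>\<^bsub>collection_group r (U_parameters i)\<^esub> collection_gen r (U_parameters i) k =
    U_class i (x + of_bool (k \<noteq> 0))"
proof (cases "k = 0")
  case True
  have "U_class i x \<in> carrier (collection_group r (U_parameters i))"
    using carrier_U_group[OF i] by blast
  then show ?thesis
    using True comm_group_collection_group[of r "U_parameters i"]
    by (simp add: collection_gen_def comm_group_def group.is_monoid monoid.r_one)
next
  case False
  interpret rels: frag_subgroup "U_relations i"
    using subgroup_collection_relations by (rule frag_subgroup_of_subgroup)
  have "collection_gen r (U_parameters i) k = U_class i 1"
    using coset_eq_U_class[OF i, of "frag_of k" 1] False k by (simp add: collection_gen_def)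
  then show ?thesis
    using False
    by (simp add: collection_group_def U_class_def rels.set_mult_r_coset frag_cmul_distrib)
qed

lemma index_difference:
  assumes "i \<in> {1..r}" "j \<in> {1..r}"
  shows "(j + r - i) mod r < r" "(j + r - i) mod r = 0 \<longleftrightarrow> i = j"
proof -
  show "(j + r - i) mod r < r"
    using r_ge_3 by simp
  show "(j + r - i) mod r = 0 \<longleftrightarrow> i = j"
  proof (cases "i \<le> j")
    case True
    then have "(j + r - i) mod r = (j - i) mod r"
      by (metis Nat.add_diff_assoc2 mod_add_self2)
    then show ?thesis
      using True assms by auto
  next
    case False
    then show ?thesis
      using assms by auto
  qed
qed

lemma quandle_parameters_U: "quandle_parameters r X (U_tri n) (U_orbit n) U_parameters"
proof -
  \<comment> \<open>The residue \<open>x\<close> goes to the \<open>x\<close>-th power of the first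
    generator; since all generators coincide, every translation by another orbit becomes
    multiplication by it.\<close>
  define f where "f = (\<lambda>(i, x). (i :: nat, U_class i x))"
  have f_el: "f (el i x) = (i, U_class i x)" if "i \<in> {1..r}" for i x
    using U_class_eq_iff[OF that, of "x mod int (n i)" x] by (simp add: f_def U_elem_def)
  have image: "f ` U_orbit n i = {i} \<times> carrier (collection_group r (U_parameters i))"
    if i: "i \<in> {1..r}" for i
  proof (intro subset_antisym subsetI)
    fix q assume "q \<in> f ` U_orbit n i"
    then obtain p where "q = f p" "p \<in> U_orbit n i"
      by blast
    moreover obtain x where "p = el i x"
      using \<open>p \<in> U_orbit n i\<close> i by (rule U_orbitE)
    ultimately show "q \<in> {i} \<times> carrier (collection_group r (U_parameters i))"
      using f_el[OF i] carrier_U_group[OF i] by simp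
  next
    fix q assume "q \<in> {i} \<times> carrier (collection_group r (U_parameters i))"
    then obtain x where "q = (i, U_class i x)"
      using carrier_U_group[OF i] by auto
    then have "q = f (el i x)"
      by (simp add: f_el[OF i])
    then show "q \<in> f ` U_orbit n i"
      using el_in_orbit_iff[OF i, of x i] by blast
  qed
  have "inj_on f X"
  proof (rule inj_onI)
    fix p q assume p: "p \<in> X" and q: "q \<in> X" and fpq: "f p = f q"
    obtain i x where i: "p = el i x" "i \<in> {1..r}"
      using p by (rule X_E)
    obtain j y where j: "q = el j y" "j \<in> {1..r}"
      using q by (rule X_E)
    show "p = q"
      using fpq f_el i j U_class_eq_iff by (auto simp: U_elem_eq_iff)
  qed
  moreover have "f ` X = param_quandle r U_parameters"
    using image unfolding U_quandle_def image_UN param_quandle_def Sigma_def by auto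
  moreover have "f (U_tri n a b) = param_tri r U_parameters (f a) (f b)"
    if a: "a \<in> X" and b: "b \<in> X" for a b
  proof -
    obtain i x where i: "a = el i x" "i \<in> {1..r}"
      using a by (rule X_E)
    obtain j y where j: "b = el j y" "j \<in> {1..r}"
      using b by (rule X_E)
    show ?thesis
      unfolding i(1) j(1) U_tri_elem f_el[OF i(2)] f_el[OF j(2)] param_tri.simps
        U_class_mult_gen[OF i(2) index_difference(1)[OF i(2) j(2)]]
        index_difference(2)[OF i(2) j(2)] ..
  qed
  ultimately have "quandle_iso f X (U_tri n) (param_quandle r U_parameters) (param_tri r U_parameters)"
    by (auto simp: quandle_iso_def bij_betw_def)
  then show ?thesis
    unfolding quandle_parameters_def
    using finite_abelian_quandle_axioms bij_betw_U_orbit parameter_collection_U image by blast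
qed

end

section \<open>The parameter group for an arbitrary parameter family\<close>

locale U_with_parameters = U_setup +
  fixes M
  assumes params: "quandle_parameters r X (U_tri n) (U_orbit n) M"
begin

abbreviation G :: "nat \<Rightarrow> (nat \<Rightarrow>\<^sub>0 int) set monoid"
  where "G i \<equiv> collection_group r (M i)"

lemma comm_group_G: "comm_group (G i)"
  by (rule comm_group_collection_group)

lemma group_G: "group (G i)"
  using comm_group_G by (simp add: comm_group_def)

definition gen :: "nat \<Rightarrow> (nat \<Rightarrow>\<^sub>0 int) set"
  where "gen i = collection_gen r (M i) 1"

lemma gen_carrier: "gen i \<in> carrier (G i)"
  unfolding gen_def using r_ge_3 by (intro collection_gen_carrier) simp

text \<open>Translation by any other orbit acts on the orbit of index \<open>i\<close> as the same cyclic
  permutation, so an isomorphism onto the parametrised quandle forces all generators of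
  \<open>G(M\<^sup>(\<^sup>i\<^sup>))\<close> to coincide.\<close>

lemma gen_properties:
  assumes i: "i \<in> {1..r}"
  shows "k \<in> {1..<r} \<Longrightarrow> collection_gen r (M i) k = gen i"
    and "y \<in> carrier (G i) \<Longrightarrow> \<exists>m::int. y = gen i [^]\<^bsub>G i\<^esub> m"
    and "gen i [^]\<^bsub>G i\<^esub> (m::int) = \<one>\<^bsub>G i\<^esub> \<longleftrightarrow> int (n i) dvd m"
proof -
  interpret G: group "G i" by (rule group_G)
  obtain f where iso: "quandle_iso f X (U_tri n) (param_quandle r M) (param_tri r M)"
    and image: "\<And>i. i \<in> {1..r} \<Longrightarrow> f ` U_orbit n i = {i} \<times> carrier (G i)"
    using params unfolding quandle_parameters_def by blast
  have hom: "f (U_tri n a b) = param_tri r M (f a) (f b)" if "a \<in> X" "b \<in> X" for a b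
    using iso that by (simp add: quandle_iso_def del: U_tri.simps param_tri.simps)
  have inj: "inj_on f X"
    using iso by (simp add: quandle_iso_def bij_betw_def)
  \<comment> \<open>\<open>\<gamma>\<close> follows orbit \<open>i\<close> through the isomorphism.
    Once \<open>power\<close> shows that it runs through the translates of \<open>\<gamma> 0\<close>
    by powers of \<open>gen i\<close>, surjectivity of \<open>f\<close> makes the group cyclic and
    injectivity gives its order.\<close>
  define \<gamma> where "\<gamma> x = snd (f (el i x))" for x
  have f_el: "f (el i x) = (i, \<gamma> x)" and \<gamma>_carrier: "\<gamma> x \<in> carrier (G i)" for x
  proof -
    have "f (el i x) \<in> {i} \<times> carrier (G i)"
      using image[OF i] imageI[of "el i x" "U_orbit n i" f] i by (simp add: el_in_orbit_iff)
    then show "f (el i x) = (i, \<gamma> x)" "\<gamma> x \<in> carrier (G i)"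
      by (auto simp: \<gamma>_def)
  qed
  have step: "\<gamma> (x + 1) = \<gamma> x \<otimes>\<^bsub>G i\<^esub> collection_gen r (M i) k" if k: "k \<in> {1..<r}" for x k
  proof -
    define j where "j = (if i + k \<le> r then i + k else i + k - r)"
    have j: "j \<in> {1..r}" "j \<noteq> i" "(j + r - i) mod r = k"
      using i k by (auto simp: j_def)
    have "fst (f (el j 0)) = j"
      using image[OF j(1)] imageI[of "el j 0" "U_orbit n j" f] j(1) by (auto simp: el_in_orbit_iff)
    then obtain b where b: "f (el j 0) = (j, b)"
      by (metis prod.collapse)
    have "f (U_tri n (el i x) (el j 0)) = param_tri r M (f (el i x)) (f (el j 0))"
      by (intro hom el_in_X i j(1))
    then show ?thesis
      using j(2) unfolding U_tri_elem f_el b param_tri.simps j(3) by simp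
  qed
  show all_gen: "collection_gen r (M i) k = gen i" if k: "k \<in> {1..<r}" for k
  proof -
    have "\<gamma> 0 \<otimes>\<^bsub>G i\<^esub> collection_gen r (M i) k = \<gamma> 0 \<otimes>\<^bsub>G i\<^esub> gen i"
      using step[OF k, of 0] step[of 1 0] r_ge_3 unfolding gen_def by simp
    then show ?thesis
      using k by (simp add: \<gamma>_carrier gen_carrier collection_gen_carrier)
  qed
  have step1: "\<gamma> (x + 1) = \<gamma> x \<otimes>\<^bsub>G i\<^esub> gen i" for x
    unfolding gen_def using r_ge_3 by (intro step) simp
  have power: "\<gamma> m = \<gamma> 0 \<otimes>\<^bsub>G i\<^esub> gen i [^]\<^bsub>G i\<^esub> m" for m :: int
  proof (induction m rule: int_induct[where k = 0])
    case base
    show ?case using \<gamma>_carrier[of 0] by simp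
  next
    case (step1 m)
    then show ?case
      using \<open>\<And>x. \<gamma> (x + 1) = \<gamma> x \<otimes>\<^bsub>G i\<^esub> gen i\<close>[of m] \<gamma>_carrier[of 0] gen_carrier[of i]
      by (simp add: G.int_pow_mult G.m_assoc)
  next
    case (step2 m)
    have "\<gamma> (m - 1) \<otimes>\<^bsub>G i\<^esub> gen i = \<gamma> 0 \<otimes>\<^bsub>G i\<^esub> gen i [^]\<^bsub>G i\<^esub> (m - 1 + 1)"
      using step1[of "m - 1"] step2(2) by simp
    also have "\<dots> = \<gamma> 0 \<otimes>\<^bsub>G i\<^esub> gen i [^]\<^bsub>G i\<^esub> (m - 1) \<otimes>\<^bsub>G i\<^esub> gen i"
      unfolding G.int_pow_mult[OF gen_carrier] using \<gamma>_carrier[of 0] gen_carrier[of i]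
      by (simp add: G.m_assoc)
    finally show ?case
      using \<gamma>_carrier gen_carrier[of i] by simp
  qed
  show "\<exists>m::int. y = gen i [^]\<^bsub>G i\<^esub> m" if y: "y \<in> carrier (G i)" for y
  proof -
    have "(i, \<gamma> 0 \<otimes>\<^bsub>G i\<^esub> y) \<in> f ` U_orbit n i"
      using image[OF i] y \<gamma>_carrier[of 0] by simp
    then obtain p where p: "p \<in> U_orbit n i" "f p = (i, \<gamma> 0 \<otimes>\<^bsub>G i\<^esub> y)"
      by (metis imageE)
    obtain m where "p = el i m"
      using p(1) i by (rule U_orbitE)
    then have "\<gamma> 0 \<otimes>\<^bsub>G i\<^esub> gen i [^]\<^bsub>G i\<^esub> m = \<gamma> 0 \<otimes>\<^bsub>G i\<^esub> y"
      using p(2) f_el[of m] power[of m] by simp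
    then have "gen i [^]\<^bsub>G i\<^esub> m = y"
      using \<gamma>_carrier gen_carrier[of i] y by simp
    then show ?thesis by blast
  qed
  show "gen i [^]\<^bsub>G i\<^esub> m = \<one>\<^bsub>G i\<^esub> \<longleftrightarrow> int (n i) dvd m" for m :: int
  proof -
    have "gen i [^]\<^bsub>G i\<^esub> m = \<one>\<^bsub>G i\<^esub> \<longleftrightarrow> \<gamma> m = \<gamma> 0"
      using power[of m] \<gamma>_carrier[of 0] gen_carrier[of i] by simp
    also have "\<dots> \<longleftrightarrow> f (el i m) = f (el i 0)"
      unfolding f_el by simp
    also have "\<dots> \<longleftrightarrow> el i m = el i 0"
      by (rule inj_on_eq_iff[OF inj el_in_X[OF i] el_in_X[OF i]])
    also have "\<dots> \<longleftrightarrow> int (n i) dvd m"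
      unfolding U_elem_eq_iff dvd_eq_mod_eq_0 by simp
    finally show ?thesis .
  qed
qed

abbreviation A :: "(nat \<Rightarrow> (nat \<Rightarrow>\<^sub>0 int) set) monoid"
  where "A \<equiv> collections_product r M"

lemma comm_group_A: "comm_group A"
proof (rule group.group_comm_groupI)
  show "group A"
    unfolding collections_product_def by (simp add: group_G)
  fix x y assume x: "x \<in> carrier A" and y: "y \<in> carrier A"
  show "x \<otimes>\<^bsub>A\<^esub> y = y \<otimes>\<^bsub>A\<^esub> x"
    unfolding collections_product_def mult_product_group
  proof (rule restrict_ext)
    fix i assume "i \<in> {1..r}"
    then have "x i \<in> carrier (G i)" "y i \<in> carrier (G i)"
      using x y by (simp_all add: collections_product_def PiE_iff)
    then show "x i \<otimes>\<^bsub>G i\<^esub> y i = y i \<otimes>\<^bsub>G i\<^esub> x i"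
      by (intro comm_monoid.m_comm comm_group.axioms(1) comm_group_G)
  qed
qed

text \<open>Presents the product of the cyclic groups as a quotient of the free abelian group
  \<open>F\<close>, so that questions about the parameter group become divisibility questions about
  exponents.\<close>

definition power_map :: "(nat \<Rightarrow>\<^sub>0 int) \<Rightarrow> nat \<Rightarrow> (nat \<Rightarrow>\<^sub>0 int) set"
  where "power_map c = (\<lambda>i\<in>{1..r}. gen i [^]\<^bsub>G i\<^esub> Poly_Mapping.lookup c i)"

abbreviation F :: "(nat \<Rightarrow>\<^sub>0 int) monoid"
  where "F \<equiv> free_Abelian_group {1..r}"

lemma power_map_carrier: "power_map c \<in> carrier A"
  using group.int_pow_closed[OF group_G gen_carrier]
  by (simp add: power_map_def collections_product_def)

lemma power_map_add: "power_map (c + d) = power_map c \<otimes>\<^bsub>A\<^esub> power_map d"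
  unfolding power_map_def collections_product_def
  by (simp add: lookup_add group.int_pow_mult[OF group_G gen_carrier] cong: restrict_cong)

sublocale power_map: group_hom F A power_map
  using comm_group_A
  by (intro group_hom.intro group_hom_axioms.intro homI)
    (simp_all add: comm_group_def power_map_carrier power_map_add)

lemma power_map_surj:
  assumes "a \<in> carrier A"
  obtains c where "Poly_Mapping.keys c \<subseteq> {1..r}" "power_map c = a"
proof -
  have "\<forall>i\<in>{1..r}. \<exists>m::int. a i = gen i [^]\<^bsub>G i\<^esub> m"
    using assms gen_properties(2) by (auto simp: collections_product_def PiE_iff)
  then obtain m where m: "\<And>i. i \<in> {1..r} \<Longrightarrow> a i = gen i [^]\<^bsub>G i\<^esub> (m i :: int)"
    by metis
  define c where "c = (\<Sum>i\<in>{1..r}. frag_cmul (m i) (frag_of i))"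
  have lookup: "Poly_Mapping.lookup c k = (if k \<in> {1..r} then m k else 0)" for k
  proof -
    have "Poly_Mapping.lookup c k = (\<Sum>i\<in>{1..r}. if i = k then m k else 0)"
      unfolding c_def lookup_sum by (intro sum.cong) auto
    then show ?thesis by simp
  qed
  show ?thesis
  proof
    show "Poly_Mapping.keys c \<subseteq> {1..r}"
      by (auto simp: in_keys_iff lookup split: if_splits)
    have "a \<in> extensional {1..r}"
      using assms by (simp add: collections_product_def PiE_def)
    then show "power_map c = a"
      unfolding power_map_def using m lookup
      by (intro extensionalityI[OF restrict_extensional]) simp_all
  qed
qed

definition total :: "(nat \<Rightarrow>\<^sub>0 int) \<Rightarrow> int"
  where "total c = (\<Sum>i\<in>{1..r}. Poly_Mapping.lookup c i)"

lemma total_simps: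
  "total 0 = 0" "total (c + d) = total c + total d" "total (c - d) = total c - total d"
  by (simp_all add: total_def lookup_add lookup_minus sum.distrib sum_subtractf)

lemma total_frag_of: "i \<in> {1..r} \<Longrightarrow> total (frag_of i) = 1"
  by (simp add: total_def)

text \<open>For \<open>r = 3\<close> this is \<open>modulus\<close>. With more orbits the parameter
  group still has this order, although the homology has no torsion.\<close>

definition torsion_order :: nat
  where "torsion_order = gcd (Gcd (n ` {1..r})) 2"

lemma torsion_order_dvd_n: "i \<in> {1..r} \<Longrightarrow> int torsion_order dvd int (n i)"
  unfolding torsion_order_def int_dvd_int_iff by (auto intro: dvd_trans[OF gcd_dvd1] Gcd_dvd)

definition relators :: "(nat \<Rightarrow> (nat \<Rightarrow>\<^sub>0 int) set) set"
  where "relators = {power_map (frag_of i + frag_of j) |i j. 1 \<le> i \<and> i < j \<and> j \<le> r}"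

lemma factor_elem_gen:
  assumes "i \<in> {1..r}" "j \<in> {1..r}" "i \<noteq> j"
  shows "factor_elem r M i (gen i) \<otimes>\<^bsub>A\<^esub> factor_elem r M j (gen j) = power_map (frag_of i + frag_of j)"
proof -
  have "factor_elem r M k (gen k) = power_map (frag_of k)" for k
    unfolding factor_elem_def power_map_def
    using group.int_pow_1[OF group_G gen_carrier] by (intro restrict_ext) simp
  then show ?thesis
    by (simp add: power_map_add)
qed

lemma parameter_group_eq: "parameter_group r M = A Mod generate A relators"
proof -
  have eq: "factor_elem r M i (collection_gen r (M i) (j - i)) \<otimes>\<^bsub>A\<^esub>
      factor_elem r M j (collection_gen r (M j) (r + i - j)) = power_map (frag_of i + frag_of j)"
    if "1 \<le> i" "i < j" "j \<le> r" for i j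
  proof -
    have i: "i \<in> {1..r}" "j - i \<in> {1..<r}" and j: "j \<in> {1..r}" "r + i - j \<in> {1..<r}"
      using that by auto
    show ?thesis
      unfolding gen_properties(1)[OF i] gen_properties(1)[OF j]
      using that by (intro factor_elem_gen i j) simp
  qed
  have "{factor_elem r M i (collection_gen r (M i) (j - i)) \<otimes>\<^bsub>A\<^esub>
      factor_elem r M j (collection_gen r (M j) (r + i - j)) |i j. 1 \<le> i \<and> i < j \<and> j \<le> r} = relators"
    unfolding relators_def
    by (intro Collect_cong iff_exI) (auto simp only: eq)
  then show ?thesis
    unfolding parameter_group_def by simp
qed

lemma relators_subset: "relators \<subseteq> carrier A"
  unfolding relators_def using power_map_carrier by blast

lemma subgroup_relations: "subgroup (generate A relators) A"
  using group.generate_is_subgroup[OF _ relators_subset] comm_group_A by (simp add: comm_group_def)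

text \<open>\<open>total\<close> modulo \<open>torsion_order\<close> is well defined on
  \<open>A\<close> because \<open>torsion_order\<close> divides every \<open>n i\<close>, and it
  kills the relators because it divides 2. Conversely, the relators identify all generators and make
  the square of the first one trivial, while its \<open>n i\<close>-th powers are trivial through
  the orders of the factors.\<close>

lemma power_map_in_relations_iff:
  assumes c: "Poly_Mapping.keys c \<subseteq> {1..r}"
  shows "power_map c \<in> generate A relators \<longleftrightarrow> int torsion_order dvd total c"
proof
  let ?D = "{c. Poly_Mapping.keys c \<subseteq> {1..r} \<and> int torsion_order dvd total c}"
  have "frag_subgroup ?D"
  proof
    show "u - v \<in> ?D" if "u \<in> ?D" "v \<in> ?D" for u v
      using that keys_diff[of u v] by (auto simp: total_simps)
  qed (simp add: total_simps)
  then have "subgroup ?D F"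
    by (rule frag_subgroup.subgroup_free_Abelian_group) simp
  then have sub: "subgroup (power_map ` ?D) A"
    by (rule power_map.subgroup_img_is_subgroup)
  have "relators \<subseteq> power_map ` ?D"
  proof
    fix a assume "a \<in> relators"
    then obtain i j where ij: "a = power_map (frag_of i + frag_of j)" "i \<in> {1..r}" "j \<in> {1..r}"
      by (auto simp: relators_def)
    have "torsion_order dvd 2"
      by (simp add: torsion_order_def)
    then have "int torsion_order dvd 2"
      using int_dvd_int_iff[of torsion_order 2] by simp
    then have "frag_of i + frag_of j \<in> ?D"
      using ij(2,3) keys_add[of "frag_of i" "frag_of j"] by (auto simp: total_simps total_frag_of)
    then show "a \<in> power_map ` ?D"
      unfolding ij(1) by (rule imageI)
  qed
  then have "generate A relators \<subseteq> power_map ` ?D"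
    using sub by (rule power_map.H.generate_subgroup_incl)
  moreover assume "power_map c \<in> generate A relators"
  ultimately obtain c' where c': "power_map c = power_map c'" "int torsion_order dvd total c'"
    by blast
  \<comment> \<open>\<open>power_map\<close> need not be injective, but exponents with the same
    image differ at \<open>i\<close> by a multiple of the order \<open>n i\<close> of
    \<open>gen i\<close>.\<close>
  have "int torsion_order dvd Poly_Mapping.lookup (c - c') i" if i: "i \<in> {1..r}" for i
  proof -
    interpret G: group "G i" by (rule group_G)
    have "gen i [^]\<^bsub>G i\<^esub> Poly_Mapping.lookup c i = gen i [^]\<^bsub>G i\<^esub> Poly_Mapping.lookup c' i"
      using fun_cong[OF c'(1), of i] i by (simp add: power_map_def)
    then have "gen i [^]\<^bsub>G i\<^esub> Poly_Mapping.lookup (c - c') i = \<one>\<^bsub>G i\<^esub>"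
      using gen_carrier[of i] by (simp add: lookup_minus G.int_pow_diff)
    then show ?thesis
      using gen_properties(3)[OF i] torsion_order_dvd_n[OF i] dvd_trans by blast
  qed
  then have "int torsion_order dvd total (c - c')"
    unfolding total_def by (rule dvd_sum)
  then show "int torsion_order dvd total c"
    using c'(2) by (simp add: total_simps dvd_diff_left_iff)
next
  let ?N = "{c. Poly_Mapping.keys c \<subseteq> {1..r} \<and> power_map c \<in> generate A relators}"
  interpret N: frag_subgroup ?N
  proof
    show "0 \<in> ?N"
      using power_map.hom_one generate.one[of A relators] by simp
    fix u v assume u: "u \<in> ?N" and v: "v \<in> ?N"
    have "power_map (u - v) = power_map u \<otimes>\<^bsub>A\<^esub> inv\<^bsub>A\<^esub> (power_map v)"
      using power_map_add[of u "- v"] power_map.hom_inv[of v] v by simp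
    then show "u - v \<in> ?N"
      using u v keys_diff[of u v] subgroup.m_closed[OF subgroup_relations]
        subgroup.m_inv_closed[OF subgroup_relations] by auto
  qed
  assume dvd: "int torsion_order dvd total c"
  have rel: "frag_of i + frag_of j \<in> ?N" if "i \<in> {1..r}" "j \<in> {1..r}" "i \<noteq> j" for i j
  proof -
    have "power_map (frag_of i + frag_of j) \<in> relators"
    proof (cases "i < j")
      case True
      then show ?thesis
        using that unfolding relators_def by auto
    next
      case False
      then have "1 \<le> j \<and> j < i \<and> i \<le> r"
        using that by auto
      then show ?thesis
        unfolding relators_def add.commute[of "frag_of i"] by blast
    qed
    then show ?thesis
      using that keys_add[of "frag_of i" "frag_of j"] generate.incl[of _ relators A] by auto
  qed
  have diff: "frag_of i - frag_of 1 \<in> ?N" if i: "i \<in> {1..r}" for i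
  proof (cases "i = 1")
    case True
    then show ?thesis using N.zero_mem by simp
  next
    case False
    \<comment> \<open>A third index: the generators of index \<open>i\<close> and 1 are both inverse
      to that of index \<open>k\<close> and hence equal.\<close>
    define k where "k = (if i = 2 then 3 else 2 :: nat)"
    have k: "k \<in> {1..r}" "k \<noteq> i" "k \<noteq> 1"
      using r_ge_3 by (auto simp: k_def)
    have "(frag_of i + frag_of k) - (frag_of 1 + frag_of k) \<in> ?N"
      using r_ge_3 k i by (intro N.diff_mem rel) auto
    then show ?thesis by simp
  qed
  have two: "frag_cmul 2 (frag_of 1) \<in> ?N"
  proof -
    have "(frag_of 1 + frag_of 2) - (frag_of 2 - frag_of 1) \<in> ?N"
      using r_ge_3 by (intro N.diff_mem rel diff) auto
    then show ?thesis
      using frag_cmul_distrib[of 1 1 "frag_of (1::nat)"] by simp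
  qed
  have "frag_cmul (int (n i)) (frag_of 1) \<in> ?N" if i: "i \<in> {1..r}" for i
  proof -
    have "power_map (frag_cmul (int (n i)) (frag_of i)) = power_map 0"
      unfolding power_map_def
    proof (rule restrict_ext)
      fix k
      show "gen k [^]\<^bsub>G k\<^esub> Poly_Mapping.lookup (frag_cmul (int (n i)) (frag_of i)) k =
          gen k [^]\<^bsub>G k\<^esub> Poly_Mapping.lookup (0 :: nat \<Rightarrow>\<^sub>0 int) k"
        using gen_properties(3)[OF i, of "int (n i)"] by (cases "k = i") simp_all
    qed
    also have "\<dots> \<in> generate A relators"
      using N.zero_mem by blast
    finally have "power_map (frag_cmul (int (n i)) (frag_of i)) \<in> generate A relators" .
    then have "frag_cmul (int (n i)) (frag_of i) \<in> ?N"
      using i keys_cmul[of "int (n i)" "frag_of i"] by (simp add: subset_iff)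
    then have "frag_cmul (int (n i)) (frag_of i) -
        frag_cmul (int (n i)) (frag_of i - frag_of 1) \<in> ?N"
      by (rule N.diff_mem[OF _ N.cmul_mem[OF diff[OF i]]])
    also have "frag_cmul (int (n i)) (frag_of i) -
        frag_cmul (int (n i)) (frag_of i - frag_of 1) = frag_cmul (int (n i)) (frag_of 1)"
      by (rule poly_mapping_eqI) (simp add: lookup_minus right_diff_distrib)
    finally show ?thesis .
  qed
  then have "frag_cmul (gcd (int (Gcd (n ` {1..r}))) 2) (frag_of 1) \<in> ?N"
    by (intro N.gcd_cmul_mem N.Gcd_cmul_mem two) auto
  then have d: "frag_cmul (int torsion_order) (frag_of 1) \<in> ?N"
    by (simp add: torsion_order_def gcd_int_def)
  have "c - frag_cmul (total c) (frag_of 1) \<in> ?N"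
    using c
  proof (induction rule: frag_induction)
    case zero
    show ?case using N.zero_mem by (simp add: total_simps)
  next
    case (one i)
    then show ?case using diff[OF one] by (simp only: total_frag_of frag_cmul_one)
  next
    case (diff u v)
    have "(u - v) - frag_cmul (total (u - v)) (frag_of 1) =
        (u - frag_cmul (total u) (frag_of 1)) - (v - frag_cmul (total v) (frag_of 1))"
      by (simp add: total_simps frag_cmul_diff_distrib)
    then show ?case
      using N.diff_mem[OF diff] by (simp only:)
  qed
  moreover obtain q where "total c = int torsion_order * q"
    using dvd by (rule dvdE)
  then have "frag_cmul (total c) (frag_of 1) \<in> ?N"
    using N.cmul_mem[OF d, of q] by (simp add: mult.commute)
  ultimately have "c - frag_cmul (total c) (frag_of 1) + frag_cmul (total c) (frag_of 1) \<in> ?N"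
    by (rule N.add_mem)
  then show "power_map c \<in> generate A relators"
    by simp
qed

lemma normal_relations: "normal (generate A relators) A"
  using comm_group_A subgroup_relations by (rule comm_group.subgroup_imp_normal)

lemma group_parameter_group: "group (parameter_group r M)"
  unfolding parameter_group_eq using normal_relations by (rule normal.factorgroup_is_group)

text \<open>Both groups are images of \<open>F\<close>, under \<open>?h\<close> and
  \<open>?t\<close>, and the two maps have the same kernel \<open>?K\<close>.\<close>

lemma parameter_group_iso: "parameter_group r M \<cong> integer_mod_group torsion_order"
proof -
  let ?N = "generate A relators"
  let ?K = "{c. Poly_Mapping.keys c \<subseteq> {1..r} \<and> int torsion_order dvd total c}"
  interpret N: normal ?N A
    by (rule normal_relations)
  let ?h = "\<lambda>c. ?N #>\<^bsub>A\<^esub> power_map c"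
  have "?h \<in> hom F (A Mod ?N)"
    using hom_compose[OF power_map.homh N.r_coset_hom_Mod] by (simp add: comp_def)
  then interpret h: group_hom F "A Mod ?N" ?h
    by (intro group_hom.intro group_hom_axioms.intro N.factorgroup_is_group group_free_Abelian_group)
  have kernel_h: "kernel F (A Mod ?N) ?h = ?K"
  proof -
    have "?h c = ?N \<longleftrightarrow> power_map c \<in> ?N" for c
      using power_map.H.coset_join1[OF _ power_map_carrier subgroup_relations]
        power_map.H.coset_join2[OF power_map_carrier subgroup_relations] by blast
    then show ?thesis
      by (auto simp: kernel_def power_map_in_relations_iff)
  qed
  have image_h: "?h ` carrier F = carrier (A Mod ?N)"
  proof
    show "carrier (A Mod ?N) \<subseteq> ?h ` carrier F"
    proof
      fix K assume "K \<in> carrier (A Mod ?N)"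
      then obtain a where a: "K = ?N #>\<^bsub>A\<^esub> a" "a \<in> carrier A"
        by (auto simp: carrier_FactGroup)
      obtain c where "Poly_Mapping.keys c \<subseteq> {1..r}" "power_map c = a"
        using a(2) by (rule power_map_surj)
      then show "K \<in> ?h ` carrier F"
        using a(1) by auto
    qed
  qed (use h.hom_closed in blast)
  have iso_param: "F Mod ?K \<cong> parameter_group r M"
    using h.FactGroup_iso[OF image_h] unfolding kernel_h parameter_group_eq .
  have d_pos: "torsion_order > 0"
    by (simp add: torsion_order_def)
  let ?t = "\<lambda>c. total c mod int torsion_order"
  have "?t \<in> hom F (integer_mod_group torsion_order)"
    using d_pos by (intro homI) (simp_all add: carrier_integer_mod_group total_simps mod_add_eq)
  then interpret t: group_hom F "integer_mod_group torsion_order" ?t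
    by (intro group_hom.intro group_hom_axioms.intro group_integer_mod_group group_free_Abelian_group)
  have kernel_t: "kernel F (integer_mod_group torsion_order) ?t = ?K"
    by (auto simp: kernel_def)
  have image_t: "?t ` carrier F = carrier (integer_mod_group torsion_order)"
  proof
    show "carrier (integer_mod_group torsion_order) \<subseteq> ?t ` carrier F"
    proof
      fix m assume m: "m \<in> carrier (integer_mod_group torsion_order)"
      have "total (frag_cmul m (frag_of 1)) = m"
        using r_ge_3 by (simp add: total_def flip: sum_distrib_left)
      then have "m = ?t (frag_cmul m (frag_of 1))"
        using m d_pos by (simp add: carrier_integer_mod_group)
      moreover have "frag_cmul m (frag_of 1) \<in> carrier F"
        using r_ge_3 by auto
      ultimately show "m \<in> ?t ` carrier F"
        by (rule image_eqI)
    qed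
  qed (use t.hom_closed in blast)
  have "group (F Mod ?K)"
    using h.normal_kernel unfolding kernel_h by (rule normal.factorgroup_is_group)
  then have "parameter_group r M \<cong> F Mod ?K"
    using iso_param by (rule group.iso_sym)
  also have "F Mod ?K \<cong> integer_mod_group torsion_order"
    using t.FactGroup_iso[OF image_t] unfolding kernel_t .
  finally (iso_trans) show ?thesis .
qed

end

theorem proposition8p7:
  fixes r :: nat and n :: "nat \<Rightarrow> nat"
  assumes "r \<ge> 3" and "\<And>i. i \<in> {1..r} \<Longrightarrow> n i \<ge> 1"
  shows "(\<exists>M. quandle_parameters r (U_quandle r n) (U_tri n) (U_orbit n) M) \<and>
    (\<forall>M. quandle_parameters r (U_quandle r n) (U_tri n) (U_orbit n) M \<longrightarrow>
       parameter_group r M \<cong> integer_mod_group (gcd (Gcd (n ` {1..r})) 2)) \<and>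
    (r = 3 \<longrightarrow>
       rack_homology 2 (U_quandle r n) (U_tri n) \<cong>
         product_group {..<9::nat} (\<lambda>_. integer_group) \<times>\<times>
         product_group {..<3::nat} (\<lambda>_. integer_mod_group (gcd (Gcd (n ` {1..r})) 2)) \<and>
       (\<forall>M. quandle_parameters r (U_quandle r n) (U_tri n) (U_orbit n) M \<longrightarrow>
          (\<forall>i\<in>{1..r}. \<forall>a\<in>U_orbit n i.
             torsion_group (U_quandle r n) (U_tri n) (U_orbit n i) a \<cong> parameter_group r M))) \<and>
    (r \<ge> 4 \<longrightarrow>
       rack_homology 2 (U_quandle r n) (U_tri n) \<cong>
         product_group {..<r\<^sup>2} (\<lambda>_. integer_group))"
proof -
  interpret U_setup r n
    using assms by unfold_locales
  have param: "parameter_group r M \<cong> integer_mod_group (gcd (Gcd (n ` {1..r})) 2)"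
    if "quandle_parameters r X (U_tri n) (U_orbit n) M" for M
  proof -
    interpret U_with_parameters r n M
      using that by unfold_locales
    show ?thesis
      using parameter_group_iso unfolding torsion_order_def .
  qed
  have homology: "rack_homology 2 X (U_tri n) \<cong>
      product_group {..<9::nat} (\<lambda>_. integer_group) \<times>\<times>
      product_group {..<3::nat} (\<lambda>_. integer_mod_group (gcd (Gcd (n ` {1..r})) 2))" if "r = 3"
  proof -
    have "{..<9::nat} = {..<r\<^sup>2}" "{..<3::nat} = {..<r}"
      using that by simp_all
    then show ?thesis
      using rack_homology_2 unfolding modulus_def if_P[OF that] by (simp only:)
  qed
  have torsion: "torsion_group X (U_tri n) (U_orbit n i) a \<cong> parameter_group r M"
    if r: "r = 3" and M: "quandle_parameters r X (U_tri n) (U_orbit n) M"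
      and i: "i \<in> {1..r}" and a: "a \<in> U_orbit n i" for M i a
  proof -
    interpret U_orbit_setup r n i
      using i by unfold_locales
    interpret U_with_parameters r n M
      using M by unfold_locales
    obtain x where a: "a = el i x"
      using a i by (rule U_orbitE)
    have "modulus = torsion_order"
      unfolding modulus_def torsion_order_def if_P[OF r] ..
    then have "torsion_group X (U_tri n) (U_orbit n i) a \<cong> integer_mod_group torsion_order"
      using group.iso_sym[OF group_integer_mod_group torsion_group_el] a by simp
    moreover have "integer_mod_group torsion_order \<cong> parameter_group r M"
      by (rule group.iso_sym[OF group_parameter_group parameter_group_iso])
    ultimately show ?thesis
      by (rule iso_trans)
  qed
  show ?thesis
  proof (intro conjI impI allI ballI)
    show "\<exists>M. quandle_parameters r X (U_tri n) (U_orbit n) M"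
      by (intro exI) (rule quandle_parameters_U)
  qed (rule param homology torsion rack_homology_2_free; assumption)+
qed

end
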